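(* Let $\pi:X\to Y$ be a factor code from a shift of finite type $X$ to an irreducible sofic shift $Y$. Then: (a) if $X$ is 1-step and $\pi$ is 1-block (so that $c^*_\pi$ is defined), $c_\pi=c^*_\pi$; (b) there are exactly $c_\pi$ transition classes over every right transitive point of $Y$; (c) given an ergodic measure $\nu$ on $Y$, $\nu$-almost every point of $Y$ has the same number of transition classes over it.
   Context: All shift spaces are one-dimensional, two-sided, over finite alphabets. A factor code is a surjective continuous shift-commuting map. For $x,x'\in X$ write $x\to x'$ if for each integer $n$ there is $v\in X$ with $\pi(v)=\pi(x)=\pi(x')$, $v_j=x_j$ for all $j\le n$, and, for some $i\ge n$, $v_j=x'_j$ for all $j\ge i$. Write $x\sim x'$ if $x\to x'$ and $x'\to x$; this is an equivalence relation whose classes are called transition classes. $\mathscr{C}_\pi(y)$ is the set of transition classes contained in $\pi^{-1}(y)$ (the transition classes over $y$). The class degree is $c_\pi=\min_{y\in Y}|\mathscr{C}_\pi(y)|$. $X$ is 1-step if $x\in X$ iff every $x_ix_{i+1}$ is a 2-block of $X$. $\pi$ is 1-block if $\pi(x)_i=\pi_{\mathrm b}(x_i)$ for a symbol map $\pi_{\mathrm b}$ between the alphabets, extended to blocks of $X$ symbol by symbol; $\pi_{\mathrm b}^{-1}(W)$ is the set of blocks of $X$ mapping to the block $W$ of $Y$. For $X$ 1-step and $\pi$ 1-block: let $W=W_0\dots W_p$ be a block of $Y$, $n$ an integer with $0<n<p$, and $M\subseteq\pi_{\mathrm b}^{-1}(W_n)$. A block $U\in\pi_{\mathrm b}^{-1}(W)$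 is routable through $a\in M$ at time $n$ if there is $U'\in\pi_{\mathrm b}^{-1}(W)$ with $U'_0=U_0$, $U'_n=a$, $U'_p=U_p$. The triple $(W,n,M)$ is a transition block of $\pi$ if every block in $\pi_{\mathrm b}^{-1}(W)$ is routable through a symbol of $M$ at time $n$. Define $c^*_\pi=\min\{|M|:(W,n,M)\text{ is a transition block of }\pi\}$. A point of $Y$ is right transitive if every block of $Y$ occurs infinitely often in its positive coordinates. Ergodic measures are shift-invariant ergodic Borel probability measures. *)

theory Defs
  imports "HOL-Probability.Probability"
begin

section \<open>Shift spaces\<close>

text \<open>A two-sided sequence is a function on the integers. Alphabets are finite sets of symbols of
  an arbitrary type; they are existentially quantified where needed, so that one can quantify over
  shift spaces with an unspecified alphabet. The topology is the product of discrete ones.\<close>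

definition seq_topology :: "(int \<Rightarrow> 'a) topology" where
  "seq_topology = product_topology (\<lambda>_. discrete_topology UNIV) UNIV"

definition shift_map :: "(int \<Rightarrow> 'a) \<Rightarrow> int \<Rightarrow> 'a" where
  "shift_map x = (\<lambda>i. x (i + 1))"

definition shift_space :: "(int \<Rightarrow> 'a) set \<Rightarrow> bool" where
  "shift_space X \<longleftrightarrow>
     (\<exists>A. finite A \<and> (\<forall>x\<in>X. range x \<subseteq> A)) \<and>
     closedin seq_topology X \<and> shift_map ` X = X"

definition word_at :: "(int \<Rightarrow> 'a) \<Rightarrow> int \<Rightarrow> nat \<Rightarrow> 'a list" where
  "word_at x i n = map (\<lambda>j. x (i + int j)) [0..<n]"

definition occurs_at :: "'a list \<Rightarrow> (int \<Rightarrow> 'a) \<Rightarrow> int \<Rightarrow> bool" where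
  "occurs_at w x i \<longleftrightarrow> word_at x i (length w) = w"

definition blocks :: "(int \<Rightarrow> 'a) set \<Rightarrow> 'a list set" where
  "blocks X = {w. \<exists>x\<in>X. \<exists>i. occurs_at w x i}"

definition sft :: "(int \<Rightarrow> 'a) set \<Rightarrow> bool" where
  "sft X \<longleftrightarrow> (\<exists>A F. finite A \<and> finite F \<and>
     X = {x. range x \<subseteq> A \<and> (\<forall>w\<in>F. \<forall>i. \<not> occurs_at w x i)})"

definition one_step :: "(int \<Rightarrow> 'a) set \<Rightarrow> bool" where
  "one_step X \<longleftrightarrow> (\<forall>x. x \<in> X \<longleftrightarrow> (\<forall>i. [x i, x (i + 1)] \<in> blocks X))"

definition irreducible_shift :: "(int \<Rightarrow> 'a) set \<Rightarrow> bool" where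
  "irreducible_shift X \<longleftrightarrow> (\<forall>u\<in>blocks X. \<forall>v\<in>blocks X. \<exists>w. u @ w @ v \<in> blocks X)"

text \<open>The values of a code outside its domain \<open>X\<close> are irrelevant.\<close>

definition factor_code :: "(int \<Rightarrow> 'a) set \<Rightarrow> (int \<Rightarrow> 'b) set \<Rightarrow> ((int \<Rightarrow> 'a) \<Rightarrow> (int \<Rightarrow> 'b)) \<Rightarrow> bool" where
  "factor_code X Y \<pi> \<longleftrightarrow> shift_space X \<and> shift_space Y \<and>
     continuous_map (subtopology seq_topology X) (subtopology seq_topology Y) \<pi> \<and>
     (\<forall>x\<in>X. \<pi> (shift_map x) = shift_map (\<pi> x)) \<and> \<pi> ` X = Y"

text \<open>A sofic shift is a factor of a shift of finite type. Since alphabets are finite, it is no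
  restriction to take the symbols of the covering shift of finite type to be natural numbers.\<close>

definition sofic :: "(int \<Rightarrow> 'b) set \<Rightarrow> bool" where
  "sofic Y \<longleftrightarrow> (\<exists>(Z :: (int \<Rightarrow> nat) set) \<phi>. sft Z \<and> factor_code Z Y \<phi>)"

definition right_transitive :: "(int \<Rightarrow> 'b) set \<Rightarrow> (int \<Rightarrow> 'b) \<Rightarrow> bool" where
  "right_transitive Y y \<longleftrightarrow> y \<in> Y \<and> (\<forall>w\<in>blocks Y. infinite {i. 0 < i \<and> occurs_at w y i})"

definition ergodic_measure :: "(int \<Rightarrow> 'b) set \<Rightarrow> (int \<Rightarrow> 'b) measure \<Rightarrow> bool" where
  "ergodic_measure Y \<nu> \<longleftrightarrow>
     prob_space \<nu> \<and> space \<nu> = Y \<and>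
     sets \<nu> = sigma_sets Y {U. openin (subtopology seq_topology Y) U} \<and>
     (\<forall>B\<in>sets \<nu>. emeasure \<nu> (shift_map -` B \<inter> Y) = emeasure \<nu> B) \<and>
     (\<forall>B\<in>sets \<nu>. shift_map -` B \<inter> Y = B \<longrightarrow> emeasure \<nu> B = 0 \<or> emeasure \<nu> B = 1)"

section \<open>Transition classes and class degree\<close>

definition transition ::
  "(int \<Rightarrow> 'a) set \<Rightarrow> ((int \<Rightarrow> 'a) \<Rightarrow> (int \<Rightarrow> 'b)) \<Rightarrow> (int \<Rightarrow> 'a) \<Rightarrow> (int \<Rightarrow> 'a) \<Rightarrow> bool" where
  "transition X \<pi> x x' \<longleftrightarrow> (\<forall>n. \<exists>v\<in>X. \<pi> v = \<pi> x \<and> \<pi> x = \<pi> x' \<and>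
     (\<forall>j\<le>n. v j = x j) \<and> (\<exists>i\<ge>n. \<forall>j\<ge>i. v j = x' j))"

definition transition_rel ::
  "(int \<Rightarrow> 'a) set \<Rightarrow> ((int \<Rightarrow> 'a) \<Rightarrow> (int \<Rightarrow> 'b)) \<Rightarrow> ((int \<Rightarrow> 'a) \<times> (int \<Rightarrow> 'a)) set" where
  "transition_rel X \<pi> =
     {(x, x'). x \<in> X \<and> x' \<in> X \<and> transition X \<pi> x x' \<and> transition X \<pi> x' x}"

definition transition_classes ::
  "(int \<Rightarrow> 'a) set \<Rightarrow> ((int \<Rightarrow> 'a) \<Rightarrow> (int \<Rightarrow> 'b)) \<Rightarrow> (int \<Rightarrow> 'b) \<Rightarrow> (int \<Rightarrow> 'a) set set" where
  "transition_classes X \<pi> y = {C \<in> X // transition_rel X \<pi>. C \<subseteq> {x \<in> X. \<pi> x = y}}"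

text \<open>Extended natural numbers are used for counting because \<open>card\<close> would assign \<open>0\<close> to infinite
  sets. A nonempty set of extended naturals contains its infimum, so the infima below are minima
  (when \<open>Y\<close> is nonempty).\<close>

definition ecard :: "'c set \<Rightarrow> enat" where
  "ecard S = (if finite S then enat (card S) else \<infinity>)"

definition class_degree ::
  "(int \<Rightarrow> 'a) set \<Rightarrow> (int \<Rightarrow> 'b) set \<Rightarrow> ((int \<Rightarrow> 'a) \<Rightarrow> (int \<Rightarrow> 'b)) \<Rightarrow> enat" where
  "class_degree X Y \<pi> = (INF y\<in>Y. ecard (transition_classes X \<pi> y))"

section \<open>Transition blocks of 1-block codes on 1-step shifts\<close>

definition one_block_code ::
  "(int \<Rightarrow> 'a) set \<Rightarrow> ((int \<Rightarrow> 'a) \<Rightarrow> (int \<Rightarrow> 'b)) \<Rightarrow> ('a \<Rightarrow> 'b) \<Rightarrow> bool" where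
  "one_block_code X \<pi> \<pi>b \<longleftrightarrow> (\<forall>x\<in>X. \<forall>i. \<pi> x i = \<pi>b (x i))"

definition block_preimages :: "(int \<Rightarrow> 'a) set \<Rightarrow> ('a \<Rightarrow> 'b) \<Rightarrow> 'b list \<Rightarrow> 'a list set" where
  "block_preimages X \<pi>b W = {U \<in> blocks X. map \<pi>b U = W}"

text \<open>A block \<open>W\<^sub>0\<dots>W\<^sub>p\<close> is a list of length \<open>p + 1\<close>.\<close>

definition routable ::
  "(int \<Rightarrow> 'a) set \<Rightarrow> ('a \<Rightarrow> 'b) \<Rightarrow> 'b list \<Rightarrow> nat \<Rightarrow> 'a \<Rightarrow> 'a list \<Rightarrow> bool" where
  "routable X \<pi>b W n a U \<longleftrightarrow> (\<exists>U'\<in>block_preimages X \<pi>b W.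
     U' ! 0 = U ! 0 \<and> U' ! n = a \<and> U' ! (length W - 1) = U ! (length W - 1))"

definition transition_block ::
  "(int \<Rightarrow> 'a) set \<Rightarrow> (int \<Rightarrow> 'b) set \<Rightarrow> ('a \<Rightarrow> 'b) \<Rightarrow> 'b list \<Rightarrow> nat \<Rightarrow> 'a set \<Rightarrow> bool" where
  "transition_block X Y \<pi>b W n M \<longleftrightarrow>
     W \<in> blocks Y \<and> 0 < n \<and> n < length W - 1 \<and>
     M \<subseteq> {a. [a] \<in> block_preimages X \<pi>b [W ! n]} \<and>
     (\<forall>U\<in>block_preimages X \<pi>b W. \<exists>a\<in>M. routable X \<pi>b W n a U)"

definition min_transition_depth ::
  "(int \<Rightarrow> 'a) set \<Rightarrow> (int \<Rightarrow> 'b) set \<Rightarrow> ('a \<Rightarrow> 'b) \<Rightarrow> enat" where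
  "min_transition_depth X Y \<pi>b = Inf {ecard M | W n M. transition_block X Y \<pi>b W n M}"

end

theory Submission imports Defs
begin

text \<open>
  Suppose that \<open>X\<close> is 1-step and that \<open>\<pi>\<close> is given by a symbol map. A point in the fiber of
  \<open>y\<close> is then a two-sided path through the layers of symbols lying over \<open>y i\<close>, two such paths can be
  spliced wherever they meet, and \<open>x \<rightarrow> x'\<close> means that from every \<open>x n\<close> some later \<open>x' i\<close> can be
  reached along a path over \<open>y\<close>. The whole argument takes place in this picture, fixed in the locale
  \<open>one_step_code\<close>.

  Transition blocks bound the number of classes from above (\<open>class_count_le_transition_block\<close>).
  Let the first component of a transition block \<open>(W, n, M)\<close> occur in \<open>y\<close> infinitely often to the
  right. Given more than \<open>card M\<close> points over \<open>y\<close>, at each occurrence two of them can be routed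
  through the same symbol of \<open>M\<close>, hence each can be led into the other; one pair does this
  infinitely often and is therefore equivalent. Every right transitive point contains all blocks in
  this way, and by irreducibility there is a point with this property for each single \<open>W\<close>
  (\<open>exists_recurring_block\<close>).

  Conversely, finitely many classes over any \<open>y\<close> produce a transition block at most as large
  (\<open>transition_block_le_class_count\<close>): \<open>M\<close> consists of the symbols that one representative of
  each class has at a suitable time. If no central block of \<open>y\<close> were a transition block with this
  \<open>M\<close>, then unroutable blocks would accumulate at a point over \<open>y\<close>; this point is
  equivalent to a representative, and the two transitions route it through \<open>M\<close>. Together the two
  bounds identify the class degree with the least size of \<open>M\<close>, and show that it is the number of
  classes over each right transitive point.

  For an ergodic measure it remains to see that the number of classes is a measurable invariant
  function of \<open>y\<close>. Non-equivalence of two points over \<open>y\<close> has a finite witness: a time from which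
  one of them never reaches the other. For a fixed bound on this time, compactness of the
  space of \<open>k\<close>-tuples of points makes the set of all \<open>y\<close> with \<open>k\<close> such pairwise non-equivalent
  points closed (\<open>closedin_separated_family\<close>), and the set of all \<open>y\<close> with at least \<open>k\<close> classes is a
  countable union of these.

  An arbitrary code on a shift of finite type is brought into the special form by passing to
  long windows, which changes neither \<open>Y\<close> nor the number of classes over its points
  (\<open>sft_recoding\<close>).
\<close>

section \<open>Topology of the sequence space\<close>

text \<open>The central cylinders form a neighbourhood base, so all topological notions can be expressed
  by agreement on central windows.\<close>

definition agree :: "nat \<Rightarrow> (int \<Rightarrow> 'a) \<Rightarrow> (int \<Rightarrow> 'a) \<Rightarrow> bool" where
  "agree N x z \<longleftrightarrow> (\<forall>i. \<bar>i\<bar> \<le> int N \<longrightarrow> x i = z i)"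

lemma finite_central_window: "finite {i::int. \<bar>i\<bar> \<le> int N}"
proof -
  have "{i::int. \<bar>i\<bar> \<le> int N} = {- int N..int N}" by auto
  then show ?thesis by simp
qed

lemma agree_mono: "agree N x z \<Longrightarrow> M \<le> N \<Longrightarrow> agree M x z"
  by (auto simp: agree_def)

lemma openin_agree: "openin seq_topology {x. agree N x z}"
proof -
  have eq: "{x. agree N x z} = PiE UNIV (\<lambda>i. if \<bar>i\<bar> \<le> int N then {z i} else UNIV)"
    by (auto simp: agree_def PiE_def Pi_def split: if_splits)
  show ?thesis
    unfolding eq seq_topology_def openin_PiE_gen
    by (rule disjI2) (auto intro!: finite_subset[OF _ finite_central_window[of N]])
qed

lemma openin_seq_topology:
  "openin seq_topology U \<longleftrightarrow> (\<forall>z\<in>U. \<exists>N. \<forall>x. agree N x z \<longrightarrow> x \<in> U)"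
proof
  assume U: "openin seq_topology U"
  show "\<forall>z\<in>U. \<exists>N. \<forall>x. agree N x z \<longrightarrow> x \<in> U"
  proof
    fix z assume "z \<in> U"
    with U obtain V where fin: "finite {i. V i \<noteq> (UNIV::'a set)}"
      and zV: "z \<in> PiE UNIV V" and sub: "PiE UNIV V \<subseteq> U"
      unfolding seq_topology_def openin_product_topology_alt by auto
    obtain N where N: "\<And>i. V i \<noteq> UNIV \<Longrightarrow> nat \<bar>i\<bar> \<le> N"
      using finite_imageI[OF fin, of "\<lambda>i. nat \<bar>i\<bar>"] unfolding finite_nat_set_iff_bounded_le by auto
    have "x \<in> U" if "agree N x z" for x
    proof -
      have "x i \<in> V i" for i
      proof (cases "V i = UNIV")
        case False
        with N[of i] that have "x i = z i" by (auto simp: agree_def)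
        with zV show ?thesis by (auto simp: PiE_def Pi_def)
      qed simp
      with sub show ?thesis by (auto simp: PiE_def Pi_def)
    qed
    then show "\<exists>N. \<forall>x. agree N x z \<longrightarrow> x \<in> U" by blast
  qed
next
  assume R: "\<forall>z\<in>U. \<exists>N. \<forall>x. agree N x z \<longrightarrow> x \<in> U"
  show "openin seq_topology U"
  proof (subst openin_subopen, intro ballI)
    fix z assume "z \<in> U"
    with R obtain N where "\<forall>x. agree N x z \<longrightarrow> x \<in> U" by blast
    then show "\<exists>T. openin seq_topology T \<and> z \<in> T \<and> T \<subseteq> U"
      by (intro exI[of _ "{x. agree N x z}"]) (auto simp: openin_agree, simp add: agree_def)
  qed
qed

lemma topspace_seq_topology [simp]: "topspace seq_topology = UNIV"
  by (simp add: seq_topology_def)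

lemma closedin_seq_topology:
  "closedin seq_topology C \<longleftrightarrow> (\<forall>z. (\<forall>N. \<exists>x\<in>C. agree N x z) \<longrightarrow> z \<in> C)"
  unfolding closedin_def openin_seq_topology topspace_seq_topology Compl_eq_Diff_UNIV[symmetric] by blast

text \<open>Compactness of the full shift over a finite alphabet, in the form of cluster points. The
  sequence need not converge to \<open>z\<close>, but each window of \<open>z\<close> is seen at arbitrarily late terms.\<close>

lemma cluster_point:
  fixes u :: "nat \<Rightarrow> int \<Rightarrow> 'a"
  assumes A: "finite A" and u: "\<And>L i. u L i \<in> A"
  obtains z where "\<And>N L. \<exists>L'\<ge>L. agree N (u L') z"
proof -
  let ?T = "product_topology (\<lambda>_::int. discrete_topology A) UNIV"
  define C where "C = (\<lambda>L. ?T closure_of (u ` {L..}))"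
  have "compact_space ?T"
    using A by (simp add: compact_space_product_topology compact_space_discrete_topology)
  moreover have "C L \<noteq> {}" for L
  proof -
    have "u ` {L..} \<subseteq> topspace ?T" using u by (auto simp: PiE_def Pi_def)
    then have "u ` {L..} \<subseteq> C L" unfolding C_def by (rule closure_of_subset)
    then show ?thesis by auto
  qed
  moreover have "decseq C"
    unfolding C_def decseq_def by (auto intro!: closure_of_mono)
  ultimately have "(\<Inter>L. C L) \<noteq> {}"
    by (intro compact_space_imp_nest[of ?T]) (auto simp: C_def)
  then obtain z where z: "\<And>L. z \<in> C L" by auto
  have zA: "z i \<in> A" for i
    using z[of 0] in_closure_of[of z ?T] unfolding C_def by (auto simp: PiE_def Pi_def)
  have "\<exists>L'\<ge>L. agree N (u L') z" for N L
  proof -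
    let ?V = "PiE UNIV (\<lambda>i. if \<bar>i\<bar> \<le> int N then {z i} else A)"
    have "openin ?T ?V"
      unfolding openin_PiE_gen
      using zA by (intro disjI2) (auto intro!: finite_subset[OF _ finite_central_window[of N]])
    moreover have "z \<in> ?V" using zA by auto
    ultimately obtain x where "x \<in> u ` {L..}" "x \<in> ?V"
      using z[of L] unfolding C_def in_closure_of by blast
    then show ?thesis by (auto simp: agree_def PiE_def Pi_def split: if_splits)
  qed
  then show thesis using that by blast
qed

text \<open>The essential half of the Curtis--Hedlund--Lyndon theorem: if larger and larger windows failed
  to determine the central symbol of the image, \<open>\<pi>\<close> would be discontinuous at a cluster point of the
  counterexamples.\<close>

lemma continuous_imp_local:
  fixes \<pi> :: "(int \<Rightarrow> 'a) \<Rightarrow> (int \<Rightarrow> 'b)"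
  assumes A: "finite A" "\<And>x i. x \<in> X \<Longrightarrow> x i \<in> A"
    and closed: "closedin seq_topology X"
    and cont: "continuous_map (subtopology seq_topology X) (subtopology seq_topology Y) \<pi>"
  obtains r where "\<And>x x'. x \<in> X \<Longrightarrow> x' \<in> X \<Longrightarrow> agree r x x' \<Longrightarrow> \<pi> x 0 = \<pi> x' 0"
proof (rule ccontr)
  assume "\<not> thesis"
  then have "\<forall>r. \<exists>x x'. x \<in> X \<and> x' \<in> X \<and> agree r x x' \<and> \<pi> x 0 \<noteq> \<pi> x' 0"
    using that by metis
  then obtain u u' where u: "\<And>r. u r \<in> X" "\<And>r. u' r \<in> X" "\<And>r. agree r (u r) (u' r)"
    "\<And>r. \<pi> (u r) 0 \<noteq> \<pi> (u' r) 0" by metis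
  obtain z where z: "\<And>N L. \<exists>L'\<ge>L. agree N (u L') z"
    using cluster_point[of A u] A u(1) by metis
  have zX: "z \<in> X"
    using closed z u(1) unfolding closedin_seq_topology by blast
  have "continuous_map (subtopology seq_topology X) seq_topology \<pi>"
    using cont by (simp add: continuous_map_in_subtopology)
  moreover have "openin seq_topology {w :: int \<Rightarrow> 'b. agree 0 w (\<pi> z)}" by (rule openin_agree)
  ultimately have "openin (subtopology seq_topology X) {x \<in> X. agree 0 (\<pi> x) (\<pi> z)}"
    by (auto simp: continuous_map_def)
  then obtain V where V: "openin seq_topology V" "{x \<in> X. agree 0 (\<pi> x) (\<pi> z)} = V \<inter> X"
    unfolding openin_subtopology by auto
  have "z \<in> V" using V(2) zX by (auto simp: agree_def)
  then obtain N where N: "\<And>x. agree N x z \<Longrightarrow> x \<in> V"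
    using V(1) unfolding openin_seq_topology by blast
  have loc: "\<pi> x 0 = \<pi> z 0" if "x \<in> X" "agree N x z" for x
    using N[OF that(2)] that(1) V(2) by (auto simp: agree_def)
  obtain L where L: "L \<ge> N" "agree N (u L) z" using z by blast
  have "agree N (u' L) z"
    using L agree_mono[OF u(3)[of L] L(1)] by (simp add: agree_def)
  then have "\<pi> (u L) 0 = \<pi> (u' L) 0" using loc L(2) u(1,2) by metis
  with u(4) show False by blast
qed

section \<open>Words and fibers\<close>

lemma length_word_at [simp]: "length (word_at x i n) = n"
  by (simp add: word_at_def)

lemma nth_word_at [simp]: "j < n \<Longrightarrow> word_at x i n ! j = x (i + int j)"
  by (simp add: word_at_def)

lemma occurs_at_iff: "occurs_at w x i \<longleftrightarrow> (\<forall>j<length w. x (i + int j) = w ! j)"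
  by (auto simp: occurs_at_def list_eq_iff_nth_eq)

lemma word_at_in_blocks: "x \<in> X \<Longrightarrow> word_at x i n \<in> blocks X"
  by (auto simp: blocks_def occurs_at_def)

definition fiber :: "(int \<Rightarrow> 'a) set \<Rightarrow> ((int \<Rightarrow> 'a) \<Rightarrow> (int \<Rightarrow> 'b)) \<Rightarrow> (int \<Rightarrow> 'b) \<Rightarrow> (int \<Rightarrow> 'a) set" where
  "fiber X \<pi> y = {x \<in> X. \<pi> x = y}"

text \<open>Comparing with all finite lower bounds avoids a case distinction on finiteness.\<close>

lemma ecard_ge_iff: "enat k \<le> ecard S \<longleftrightarrow> (\<exists>T\<subseteq>S. finite T \<and> card T = k)"
proof (cases "finite S")
  case True
  then show ?thesis by (metis ecard_def enat_ord_simps(1) card_mono obtain_subset_with_card_n)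
next
  case False
  then show ?thesis using infinite_arbitrarily_large[OF False, of k] by (auto simp: ecard_def)
qed

section \<open>Paths over a point for 1-block codes on 1-step shifts\<close>

locale one_step_code =
  fixes X :: "(int \<Rightarrow> 'a) set" and \<pi> :: "(int \<Rightarrow> 'a) \<Rightarrow> (int \<Rightarrow> 'b)"
    and \<pi>b :: "'a \<Rightarrow> 'b" and A :: "'a set"
  assumes finite_alphabet: "finite A"
    and in_alphabet: "x \<in> X \<Longrightarrow> x i \<in> A"
    and one_step: "one_step X"
    and one_block: "one_block_code X \<pi> \<pi>b"
begin

lemma code_nth: "x \<in> X \<Longrightarrow> \<pi> x i = \<pi>b (x i)"
  using one_block by (auto simp: one_block_code_def)

lemma fiber_iff: "x \<in> fiber X \<pi> y \<longleftrightarrow> x \<in> X \<and> (\<forall>i. \<pi>b (x i) = y i)"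
  by (auto simp: fiber_def code_nth[symmetric])

lemma two_block: "x \<in> X \<Longrightarrow> [x i, x (i + 1)] \<in> blocks X"
  using one_step by (auto simp: one_step_def)

lemma in_X_I: "(\<And>i. \<exists>x\<in>X. \<exists>j. x j = z i \<and> x (j + 1) = z (i + 1)) \<Longrightarrow> z \<in> X"
  using one_step two_block unfolding one_step_def by metis

lemma translate_in_X: "x \<in> X \<Longrightarrow> (\<lambda>i. x (i + k)) \<in> X"
proof (rule in_X_I)
  fix i assume "x \<in> X"
  moreover have "x (i + k + 1) = x (i + 1 + k)" by (simp add: ac_simps)
  ultimately show "\<exists>u\<in>X. \<exists>j. u j = x (i + k) \<and> u (j + 1) = x (i + 1 + k)" by blast
qed

lemma splice_in_X:
  assumes "x \<in> X" "x' \<in> X" "x m = x' m"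
  shows "(\<lambda>i. if i \<le> m then x i else x' i) \<in> X"
proof (rule in_X_I)
  fix i
  show "\<exists>u\<in>X. \<exists>j. u j = (if i \<le> m then x i else x' i) \<and> u (j + 1) = (if i + 1 \<le> m then x (i + 1) else x' (i + 1))"
  proof (cases "i + 1 \<le> m")
    case True
    then show ?thesis using assms(1) by auto
  next
    case False
    then have "x' i = (if i \<le> m then x i else x' i)" using assms(3) by (cases "i = m") auto
    then show ?thesis using assms(2) False by auto
  qed
qed

lemma cluster_in_X:
  assumes "\<And>N. \<exists>x\<in>X. agree N x z"
  shows "z \<in> X"
proof (rule in_X_I)
  fix i
  obtain x where x: "x \<in> X" "agree (nat (\<bar>i\<bar> + 1)) x z" using assms by blast
  then have "x i = z i" "x (i + 1) = z (i + 1)" by (auto simp: agree_def)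
  with x(1) show "\<exists>x\<in>X. \<exists>j. x j = z i \<and> x (j + 1) = z (i + 1)" by blast
qed

text \<open>A path over \<open>y\<close> from \<open>a\<close> at time \<open>m\<close> to \<open>b\<close> at time \<open>n\<close>. Using a whole point of \<open>X\<close> as
  the path, with the image constrained only between the two times, saves extending words to points
  whenever paths are joined.\<close>

definition reach :: "(int \<Rightarrow> 'b) \<Rightarrow> int \<Rightarrow> 'a \<Rightarrow> int \<Rightarrow> 'a \<Rightarrow> bool" where
  "reach y m a n b \<longleftrightarrow> (\<exists>x\<in>X. x m = a \<and> x n = b \<and> (\<forall>i. m \<le> i \<and> i \<le> n \<longrightarrow> \<pi>b (x i) = y i))"

lemma reach_cong:
  "(\<And>i. m \<le> i \<Longrightarrow> i \<le> n \<Longrightarrow> y i = y' i) \<Longrightarrow> reach y m a n b \<longleftrightarrow> reach y' m a n b"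
  by (auto simp: reach_def)

lemma reach_along:
  "x \<in> X \<Longrightarrow> (\<And>i. m \<le> i \<Longrightarrow> i \<le> n \<Longrightarrow> \<pi>b (x i) = y i) \<Longrightarrow> reach y m (x m) n (x n)"
  by (auto simp: reach_def)

lemma reach_join:
  assumes "reach y l a m b" "reach y m b n c" "l \<le> m" "m \<le> n"
  obtains x where "x \<in> X" "x l = a" "x m = b" "x n = c"
    "\<And>i. l \<le> i \<Longrightarrow> i \<le> n \<Longrightarrow> \<pi>b (x i) = y i"
proof -
  obtain u v where u: "u \<in> X" "u l = a" "u m = b" "\<forall>i. l \<le> i \<and> i \<le> m \<longrightarrow> \<pi>b (u i) = y i"
    and v: "v \<in> X" "v m = b" "v n = c" "\<forall>i. m \<le> i \<and> i \<le> n \<longrightarrow> \<pi>b (v i) = y i"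
    using assms(1,2) unfolding reach_def by auto
  have "(\<lambda>i. if i \<le> m then u i else v i) \<in> X"
    using u v by (intro splice_in_X) auto
  with u v assms(3,4) show thesis by (intro that[of "\<lambda>i. if i \<le> m then u i else v i"]) auto
qed

lemma reach_trans:
  assumes "reach y l a m b" "reach y m b n c" "l \<le> m" "m \<le> n"
  shows "reach y l a n c"
  using reach_join[OF assms] unfolding reach_def by metis

lemma reach_extend_right:
  assumes "x \<in> fiber X \<pi> y" "reach y l a m (x m)" "l \<le> m" "m \<le> n"
  shows "reach y l a n (x n)"
proof -
  have "reach y m (x m) n (x n)" using assms(1) by (intro reach_along) (auto simp: fiber_iff)
  then show ?thesis using assms reach_trans by blast
qed

lemma reach_extend_left:
  assumes "x \<in> fiber X \<pi> y" "reach y m (x m) n b" "l \<le> m" "m \<le> n"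
  shows "reach y l (x l) n b"
proof -
  have "reach y l (x l) m (x m)" using assms(1) by (intro reach_along) (auto simp: fiber_iff)
  then show ?thesis using assms reach_trans by blast
qed

text \<open>The point required by a transition at time \<open>n\<close> is spliced from \<open>x\<close>, the connecting path and
  \<open>x'\<close>. So a transition depends only on the connecting paths.\<close>

lemma transition_iff_reach:
  assumes x: "x \<in> fiber X \<pi> y" and x': "x' \<in> fiber X \<pi> y"
  shows "transition X \<pi> x x' \<longleftrightarrow> (\<forall>n. \<exists>i\<ge>n. reach y n (x n) i (x' i))"
proof
  assume T: "transition X \<pi> x x'"
  show "\<forall>n. \<exists>i\<ge>n. reach y n (x n) i (x' i)"
  proof
    fix n
    obtain v i where v: "v \<in> X" "\<pi> v = \<pi> x" "v n = x n" "i \<ge> n" "v i = x' i"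
      using T unfolding transition_def by (metis order_refl)
    have "v \<in> fiber X \<pi> y" using v(1,2) x by (auto simp: fiber_def)
    then have "reach y n (v n) i (v i)" by (intro reach_along) (auto simp: fiber_iff)
    with v show "\<exists>i\<ge>n. reach y n (x n) i (x' i)" by auto
  qed
next
  assume R: "\<forall>n. \<exists>i\<ge>n. reach y n (x n) i (x' i)"
  show "transition X \<pi> x x'"
    unfolding transition_def
  proof
    fix n
    obtain i w where i: "i \<ge> n" and w: "w \<in> X" "w n = x n" "w i = x' i"
      "\<forall>j. n \<le> j \<and> j \<le> i \<longrightarrow> \<pi>b (w j) = y j"
      using R unfolding reach_def by metis
    define u where "u = (\<lambda>j. if j \<le> n then x j else w j)"
    define v where "v = (\<lambda>j. if j \<le> i then u j else x' j)"
    have u: "u \<in> X" unfolding u_def using x w by (intro splice_in_X) (auto simp: fiber_def)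
    have "u i = x' i" using i w by (auto simp: u_def)
    then have "v \<in> X" unfolding v_def using u x' by (intro splice_in_X) (auto simp: fiber_def)
    moreover have "\<pi>b (v j) = y j" for j
      using x x' w(4) by (auto simp: v_def u_def fiber_iff)
    ultimately have "v \<in> fiber X \<pi> y" by (auto simp: fiber_iff)
    moreover have "\<forall>j\<le>n. v j = x j" using i by (auto simp: v_def u_def)
    moreover have "\<forall>j\<ge>i. v j = x' j" using \<open>u i = x' i\<close> by (auto simp: v_def)
    ultimately show "\<exists>v\<in>X. \<pi> v = \<pi> x \<and> \<pi> x = \<pi> x' \<and> (\<forall>j\<le>n. v j = x j) \<and>
        (\<exists>i\<ge>n. \<forall>j\<ge>i. v j = x' j)"
      using i x x' by (auto simp: fiber_def)
  qed
qed

lemma transition_rel_iff_reach: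
  assumes "x \<in> fiber X \<pi> y" "x' \<in> fiber X \<pi> y"
  shows "(x, x') \<in> transition_rel X \<pi> \<longleftrightarrow>
    (\<forall>n. \<exists>i\<ge>n. reach y n (x n) i (x' i)) \<and> (\<forall>n. \<exists>i\<ge>n. reach y n (x' n) i (x i))"
  using assms transition_iff_reach[OF assms] transition_iff_reach[OF assms(2,1)]
  by (auto simp: transition_rel_def fiber_def)

lemma transition_rel_same_fiber:
  "(x, x') \<in> transition_rel X \<pi> \<Longrightarrow> x \<in> fiber X \<pi> (\<pi> x) \<and> x' \<in> fiber X \<pi> (\<pi> x)"
  by (auto simp: transition_rel_def transition_def fiber_def)

lemma transition_trans:
  assumes "x \<in> fiber X \<pi> y" "x' \<in> fiber X \<pi> y" "x'' \<in> fiber X \<pi> y"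
    and "transition X \<pi> x x'" "transition X \<pi> x' x''"
  shows "transition X \<pi> x x''"
  unfolding transition_iff_reach[OF assms(1,3)]
proof
  fix n
  obtain i where i: "i \<ge> n" "reach y n (x n) i (x' i)"
    using assms(4) unfolding transition_iff_reach[OF assms(1,2)] by blast
  obtain k where "k \<ge> i" "reach y i (x' i) k (x'' k)"
    using assms(5) unfolding transition_iff_reach[OF assms(2,3)] by blast
  with i reach_trans show "\<exists>i\<ge>n. reach y n (x n) i (x'' i)" by (meson order_trans)
qed

lemma equiv_transition_rel: "equiv X (transition_rel X \<pi>)"
proof (rule equivI)
  show "transition_rel X \<pi> \<subseteq> X \<times> X" by (auto simp: transition_rel_def)
  show "refl_on X (transition_rel X \<pi>)"
  proof (rule refl_onI)
    fix x assume "x \<in> X"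
    then have "x \<in> fiber X \<pi> (\<pi> x)" by (simp add: fiber_def)
    moreover from this have "\<forall>n. \<exists>i\<ge>n. reach (\<pi> x) n (x n) i (x i)"
      by (metis order_refl fiber_iff reach_along)
    ultimately show "(x, x) \<in> transition_rel X \<pi>"
      using transition_rel_iff_reach by blast
  qed
  show "sym (transition_rel X \<pi>)" by (auto simp: sym_def transition_rel_def)
  show "trans (transition_rel X \<pi>)"
  proof (rule transI)
    fix x x' x'' assume a: "(x, x') \<in> transition_rel X \<pi>" "(x', x'') \<in> transition_rel X \<pi>"
    have "x \<in> fiber X \<pi> (\<pi> x)" "x' \<in> fiber X \<pi> (\<pi> x)" "x'' \<in> fiber X \<pi> (\<pi> x)"
      using transition_rel_same_fiber[OF a(1)] transition_rel_same_fiber[OF a(2)]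
      by (auto simp: fiber_def)
    note f = this
    have "transition X \<pi> x x''" "transition X \<pi> x'' x"
      using a transition_trans[OF f] transition_trans[OF f(3,2,1)]
      by (simp_all add: transition_rel_def)
    then show "(x, x'') \<in> transition_rel X \<pi>"
      using f by (simp add: transition_rel_def fiber_def)
  qed
qed

text \<open>Equivalent points have the same image, so a class lies in the fiber as soon as one of its
  points does.\<close>

lemma transition_classes_eq:
  "transition_classes X \<pi> y = (\<lambda>x. transition_rel X \<pi> `` {x}) ` fiber X \<pi> y"
proof -
  have "transition_rel X \<pi> `` {x} \<subseteq> {x' \<in> X. \<pi> x' = y} \<longleftrightarrow> \<pi> x = y" if "x \<in> X" for x
    using equiv_class_self[OF equiv_transition_rel that]
    by (auto simp: transition_rel_def transition_def)
  then show ?thesis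
    by (auto simp: transition_classes_def quotient_def fiber_def)
qed

text \<open>Counting classes by families of pairwise inequivalent points is what both the pigeonhole
  argument and the compactness argument for measurability can work with.\<close>

lemma class_count_ge_iff:
  "enat k \<le> ecard (transition_classes X \<pi> y) \<longleftrightarrow>
    (\<exists>z::nat \<Rightarrow> int \<Rightarrow> 'a. (\<forall>j<k. z j \<in> fiber X \<pi> y) \<and>
      (\<forall>j<k. \<forall>l<k. j \<noteq> l \<longrightarrow> (z j, z l) \<notin> transition_rel X \<pi>))" (is "?L \<longleftrightarrow> ?R")
proof
  assume ?L
  then obtain T where T: "T \<subseteq> transition_classes X \<pi> y" "finite T" "card T = k"
    unfolding ecard_ge_iff by blast
  obtain c where c: "bij_betw c {0..<k} T" using T ex_bij_betw_nat_finite by blast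
  have "\<exists>x. x \<in> fiber X \<pi> y \<and> c j = transition_rel X \<pi> `` {x}" if "j < k" for j
    using bij_betwE[OF c] T(1) that unfolding transition_classes_eq by fastforce
  then obtain z where z: "\<And>j. j < k \<Longrightarrow> z j \<in> fiber X \<pi> y"
    "\<And>j. j < k \<Longrightarrow> c j = transition_rel X \<pi> `` {z j}" by metis
  have "(z j, z l) \<notin> transition_rel X \<pi>" if "j < k" "l < k" "j \<noteq> l" for j l
  proof
    assume "(z j, z l) \<in> transition_rel X \<pi>"
    then have "c j = c l" using z that equiv_class_eq[OF equiv_transition_rel] by metis
    with c that show False by (auto simp: bij_betw_def inj_on_def)
  qed
  with z show ?R by blast
next
  assume ?R
  then obtain z where z: "\<And>j. j < k \<Longrightarrow> z j \<in> fiber X \<pi> y"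
      "\<And>j l. j < k \<Longrightarrow> l < k \<Longrightarrow> j \<noteq> l \<Longrightarrow> (z j, z l) \<notin> transition_rel X \<pi>" by blast
  let ?c = "\<lambda>j. transition_rel X \<pi> `` {z j}"
  have "inj_on ?c {..<k}"
    using z by (auto simp: inj_on_def fiber_def dest!: eq_equiv_class[OF _ equiv_transition_rel])
  then have "card (?c ` {..<k}) = k" by (simp add: card_image)
  moreover have "?c ` {..<k} \<subseteq> transition_classes X \<pi> y"
    using z(1) by (auto simp: transition_classes_eq)
  ultimately show ?L unfolding ecard_ge_iff by (metis finite_imageI finite_lessThan)
qed

end

section \<open>Points with a recurring block\<close>

lemma shift_space_translate:
  assumes "shift_space Y" "y \<in> Y"
  shows "(\<lambda>i. y (i + k)) \<in> Y"
proof (induction k rule: int_induct[of _ 0])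
  case base
  then show ?case using assms(2) by simp
next
  case (step1 k)
  then have "shift_map (\<lambda>i. y (i + k)) \<in> Y" using assms(1) by (auto simp: shift_space_def)
  moreover have "shift_map (\<lambda>i. y (i + k)) = (\<lambda>i. y (i + (k + 1)))"
    by (simp add: shift_map_def fun_eq_iff ac_simps)
  ultimately show ?case by simp
next
  case (step2 k)
  then obtain x where x: "x \<in> Y" "shift_map x = (\<lambda>i. y (i + k))"
    using assms(1) unfolding shift_space_def by (metis imageE)
  have "x i = y (i + (k - 1))" for i
    using fun_cong[OF x(2), of "i - 1"] by (simp add: shift_map_def algebra_simps)
  then have "x = (\<lambda>i. y (i + (k - 1)))" by auto
  with x(1) show ?case by simp
qed

text \<open>Irreducibility extends \<open>W\<close> step by step to blocks \<open>B k\<close>, each a prefix of the next and each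
  ending in a further copy of \<open>W\<close>. Points of \<open>Y\<close> showing \<open>B k\<close> at time 1 have a cluster point
  that shows all of them.\<close>

lemma exists_recurring_block:
  assumes Y: "shift_space Y" and irr: "irreducible_shift Y" and W: "W \<in> blocks Y" "W \<noteq> []"
  obtains y where "y \<in> Y" "infinite {p. 0 < p \<and> occurs_at W y p}"
proof -
  obtain f where f: "\<And>u. u \<in> blocks Y \<Longrightarrow> u @ f u @ W \<in> blocks Y"
  proof -
    have "\<forall>u. \<exists>w. u \<in> blocks Y \<longrightarrow> u @ w @ W \<in> blocks Y"
      using irr W(1) unfolding irreducible_shift_def by blast
    from choice[OF this] that show thesis by blast
  qed
  define B where "B = rec_nat W (\<lambda>_ u. u @ f u @ W)"
  have B0: "B 0 = W" and BS: "B (Suc k) = B k @ f (B k) @ W" for k by (simp_all add: B_def)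
  have Bblock: "B k \<in> blocks Y" for k by (induction k) (auto simp: B0 BS W f)
  have prefix: "\<exists>v. B (k + d) = B k @ v" for k d
    by (induction d) (auto simp: BS)
  have suffix: "\<exists>v. B k = v @ W" for k
    by (cases k) (auto simp: B0 BS)
  have "\<exists>x\<in>Y. occurs_at (B k) x 1" for k
  proof -
    obtain x i where x: "x \<in> Y" "occurs_at (B k) x i" using Bblock[of k] by (auto simp: blocks_def)
    then have "occurs_at (B k) (\<lambda>j. x (j + (i - 1))) 1"
      by (auto simp: occurs_at_iff algebra_simps)
    then show ?thesis using shift_space_translate[OF Y x(1)] by blast
  qed
  then obtain x where x: "\<And>k. x k \<in> Y" "\<And>k. occurs_at (B k) (x k) 1" by metis
  obtain A where A: "finite A" "\<And>y i. y \<in> Y \<Longrightarrow> y i \<in> A"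
    using Y unfolding shift_space_def by (metis rangeI subsetD)
  obtain z where z: "\<And>N L. \<exists>L'\<ge>L. agree N (x L') z"
    using cluster_point[of A x] A x(1) by metis
  have "z \<in> Y" using z x(1) Y unfolding shift_space_def closedin_seq_topology by blast
  define p where "p k = 1 + int (length (B k)) - int (length W)" for k
  have len: "length W \<le> length (B k)" for k using suffix[of k] by auto
  have occ: "occurs_at W z (p k)" for k
    unfolding occurs_at_iff
  proof (intro allI impI)
    fix j assume j: "j < length W"
    obtain l where l: "l \<ge> k" "agree (length (B k)) (x l) z" using z by blast
    obtain v where v: "B l = B k @ v" using prefix[of k "l - k"] l(1) by auto
    obtain v' where v': "B k = v' @ W" using suffix by blast
    have eq: "p k + int j = 1 + int (length v' + j)" by (simp add: p_def v')
    have "z (p k + int j) = x l (p k + int j)"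
      using l(2) j by (simp add: agree_def eq v')
    also have "\<dots> = B l ! (length v' + j)"
      using x(2)[of l] j unfolding occurs_at_iff eq by (auto simp: v v' dest!: spec[of _ "length v' + j"])
    also have "\<dots> = W ! j" using j by (simp add: v v' nth_append)
    finally show "z (p k + int j) = W ! j" .
  qed
  have "strict_mono (\<lambda>k. length (B k))"
    using W(2) by (intro strict_monoI_Suc) (simp add: BS)
  then have "inj (\<lambda>k. length (B k))" by (rule strict_mono_imp_inj_on)
  then have "inj p" by (auto simp: inj_def p_def)
  then have "infinite (range p)" using finite_imageD by blast
  moreover have "range p \<subseteq> {p. 0 < p \<and> occurs_at W z p}"
    using occ len by (auto simp: p_def add_strict_increasing)
  ultimately have "infinite {p. 0 < p \<and> occurs_at W z p}" using infinite_super by blast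
  with \<open>z \<in> Y\<close> show thesis using that by blast
qed

context one_step_code begin

section \<open>Transition blocks and the number of classes\<close>

lemma block_preimage_point:
  assumes "U \<in> block_preimages X \<pi>b W"
  obtains v where "v \<in> X" "\<And>j. j < length W \<Longrightarrow> v (p + int j) = U ! j"
    "\<And>i. p \<le> i \<Longrightarrow> i < p + int (length W) \<Longrightarrow> \<pi>b (v i) = W ! nat (i - p)"
proof -
  obtain u k where u: "u \<in> X" "occurs_at U u k" and W: "W = map \<pi>b U"
    using assms by (auto simp: block_preimages_def blocks_def)
  have 1: "u (p + int j + (k - p)) = U ! j" if "j < length W" for j
    using u(2) that W by (simp add: occurs_at_iff add.commute)
  have "\<pi>b (u (i + (k - p))) = W ! nat (i - p)" if "p \<le> i" "i < p + int (length W)" for i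
    using 1[of "nat (i - p)"] that W by simp
  with 1 show thesis using translate_in_X[OF u(1)] that by blast
qed

text \<open>Two points routed through the same symbol of \<open>M\<close> at one occurrence of \<open>W\<close> can each be led into
  the other within this occurrence. Among more than \<open>card M\<close> points, each occurrence yields such a
  pair, and since there are only finitely many pairs, one of them is obtained infinitely often.\<close>

lemma class_count_le_transition_block:
  assumes tb: "transition_block X Y \<pi>b W n M"
    and inf: "infinite {p. 0 < p \<and> occurs_at W y p}"
  shows "ecard (transition_classes X \<pi> y) \<le> ecard M"
proof (cases "finite M")
  case False
  then show ?thesis by (simp add: ecard_def)
next
  case fin: True
  define q where "q = length W - 1"
  define P where "P = {p. 0 < p \<and> occurs_at W y p}"
  have n: "0 < n" "n < q" and len: "length W = Suc q"
    using tb by (auto simp: transition_block_def q_def)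
  show ?thesis
  proof (rule ccontr)
    assume "\<not> ?thesis"
    then have "enat (Suc (card M)) \<le> ecard (transition_classes X \<pi> y)"
      using fin by (simp add: ecard_def Suc_ile_eq not_le)
    then obtain z where z: "\<And>j. j < Suc (card M) \<Longrightarrow> z j \<in> fiber X \<pi> y"
      and ineq: "\<And>j l. j < Suc (card M) \<Longrightarrow> l < Suc (card M) \<Longrightarrow> j \<noteq> l \<Longrightarrow> (z j, z l) \<notin> transition_rel X \<pi>"
      unfolding class_count_ge_iff by blast
    have "\<exists>a\<in>M. reach y p (z j p) (p + n) a \<and> reach y (p + n) a (p + q) (z j (p + q))"
      if p: "p \<in> P" and j: "j < Suc (card M)" for p j
    proof -
      have yW: "y i = W ! nat (i - p)" if "p \<le> i" "i < p + int (length W)" for i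
        using p that unfolding P_def occurs_at_iff by (auto dest!: spec[of _ "nat (i - p)"])
      have zX: "z j \<in> X" "\<And>i. \<pi>b (z j i) = y i" using z[OF j] by (auto simp: fiber_iff)
      have "word_at (z j) p (length W) \<in> block_preimages X \<pi>b W"
        using zX yW by (auto simp: block_preimages_def word_at_in_blocks list_eq_iff_nth_eq)
      then obtain a U' where a: "a \<in> M" and U': "U' \<in> block_preimages X \<pi>b W"
        "U' ! 0 = z j p" "U' ! n = a" "U' ! q = z j (p + q)"
        using tb n len unfolding transition_block_def routable_def by fastforce
      obtain v where v: "v \<in> X" "\<And>j. j < length W \<Longrightarrow> v (p + int j) = U' ! j"
        "\<And>i. p \<le> i \<Longrightarrow> i < p + int (length W) \<Longrightarrow> \<pi>b (v i) = W ! nat (i - p)"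
        using block_preimage_point[OF U'(1)] by metis
      have "v p = z j p" "v (p + n) = a" "v (p + q) = z j (p + q)"
        using v(2)[of 0] v(2)[of n] v(2)[of q] U' n len by auto
      then have "reach y p (z j p) (p + n) a \<and> reach y (p + n) a (p + q) (z j (p + q))"
        using n len unfolding reach_def
        by (intro conjI bexI[OF _ v(1)]) (auto simp: v(3) yW)
      with a show ?thesis by blast
    qed
    then obtain g where g: "\<And>p j. p \<in> P \<Longrightarrow> j < Suc (card M) \<Longrightarrow> g p j \<in> M \<and>
        reach y p (z j p) (p + n) (g p j) \<and> reach y (p + n) (g p j) (p + q) (z j (p + q))"
      by metis
    have "\<exists>jl. fst jl < Suc (card M) \<and> snd jl < Suc (card M) \<and> fst jl \<noteq> snd jl \<and>
        g p (fst jl) = g p (snd jl)" if "p \<in> P" for p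
    proof -
      have "g p j \<in> M" if "j < Suc (card M)" for j using g[OF \<open>p \<in> P\<close> that] by simp
      then have "g p ` {..<Suc (card M)} \<subseteq> M" by blast
      from card_mono[OF fin this] have "card (g p ` {..<Suc (card M)}) < card {..<Suc (card M)}"
        by simp
      then have "\<not> inj_on (g p) {..<Suc (card M)}" by (rule pigeonhole)
      then obtain j l where "j < Suc (card M)" "l < Suc (card M)" "j \<noteq> l" "g p j = g p l"
        unfolding inj_on_def by blast
      then show ?thesis by (intro exI[of _ "(j, l)"]) simp
    qed
    then obtain h where h: "\<And>p. p \<in> P \<Longrightarrow> fst (h p) < Suc (card M) \<and> snd (h p) < Suc (card M) \<and>
        fst (h p) \<noteq> snd (h p) \<and> g p (fst (h p)) = g p (snd (h p))" by metis
    have "h ` P \<subseteq> {..<Suc (card M)} \<times> {..<Suc (card M)}"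
      using h by (simp add: image_subset_iff mem_Times_iff)
    then have "finite (h ` P)" by (rule finite_subset) simp
    then obtain p0 where p0: "p0 \<in> P" "infinite {p \<in> P. h p = h p0}"
      using pigeonhole_infinite[of P h] inf unfolding P_def by blast
    obtain j l where jl: "h p0 = (j, l)" by (cases "h p0")
    \<comment> \<open>Infinitely many positive times are unbounded to the right. This is where occurrences at
      positive times enter: transitions only look to the right.\<close>
    have unbounded: "\<exists>p\<in>P. h p = (j, l) \<and> p \<ge> m" for m
    proof (rule ccontr)
      assume "\<not> ?thesis"
      then have "{p \<in> P. h p = h p0} \<subseteq> {0..m}" unfolding jl by (force simp: P_def)
      with p0(2) show False using finite_subset by blast
    qed
    have jl': "j < Suc (card M)" "l < Suc (card M)" "j \<noteq> l" using h[OF p0(1)] jl by auto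
    have "\<forall>m. \<exists>i\<ge>m. reach y m (z j m) i (z l i)" "\<forall>m. \<exists>i\<ge>m. reach y m (z l m) i (z j i)"
    proof -
      have *: "\<exists>i\<ge>m. reach y m (z b m) i (z c i)"
        if "\<And>p. h p = (j, l) \<Longrightarrow> p \<in> P \<Longrightarrow> g p b = g p c" "b < Suc (card M)" "c < Suc (card M)" for b c m
      proof -
        obtain p where p: "p \<in> P" "h p = (j, l)" "p \<ge> m" using unbounded by blast
        have "reach y p (z b p) (p + q) (z c (p + q))"
          using g[OF p(1) that(2)] g[OF p(1) that(3)] that(1)[OF p(2,1)] n
          by (intro reach_trans[of y p "z b p" "p + n" "g p b" "p + q"]) auto
        from reach_extend_left[OF z[OF that(2)] this] have "reach y m (z b m) (p + q) (z c (p + q))"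
          using p(3) by simp
        with p(3) show ?thesis by (intro exI[of _ "p + q"]) auto
      qed
      have "g p j = g p l" if "h p = (j, l)" "p \<in> P" for p using h[OF that(2)] that(1) by simp
      then show "\<forall>m. \<exists>i\<ge>m. reach y m (z j m) i (z l i)" "\<forall>m. \<exists>i\<ge>m. reach y m (z l m) i (z j i)"
        using *[of j l] *[of l j] jl' by auto
    qed
    then have "(z j, z l) \<in> transition_rel X \<pi>"
      using transition_rel_iff_reach[OF z[OF jl'(1)] z[OF jl'(2)]] by blast
    with ineq jl' show False by blast
  qed
qed

text \<open>Let \<open>T\<close> represent the classes over \<open>y\<close>. As there are finitely many symbols, there is a time
  \<open>m\<close> by which every symbol at time 0 that can reach a representative \<open>t\<close> at all has reached it,
  and \<open>M\<close> collects the symbols of the representatives at time \<open>m\<close>. Fixing the start at time 0 before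
  choosing \<open>m\<close> matters: a transition promises to reach \<open>t\<close> eventually, but not by a given time.
  If \<open>z\<close> is a point over \<open>y\<close> equivalent to \<open>t\<close>, then \<open>z 0\<close> reaches \<open>t m\<close>, from where \<open>z\<close> is
  reached again at some time \<open>k\<close>. Every block of \<open>X\<close> over a central block of \<open>y\<close> that agrees with
  \<open>z\<close> up to time \<open>k\<close> inherits this detour, so not all long central blocks of \<open>y\<close> can have
  unroutable preimages.\<close>

lemma transition_block_le_class_count:
  assumes y: "y \<in> Y" and fin: "finite (transition_classes X \<pi> y)"
  obtains W n M where "transition_block X Y \<pi>b W n M" "ecard M \<le> ecard (transition_classes X \<pi> y)"
proof -
  let ?R = "transition_rel X \<pi>"
  obtain T where T: "T \<subseteq> fiber X \<pi> y" "transition_classes X \<pi> y = (\<lambda>x. ?R `` {x}) ` T"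
      "inj_on (\<lambda>x. ?R `` {x}) T"
    using subset_image_inj[of "transition_classes X \<pi> y" "\<lambda>x. ?R `` {x}" "fiber X \<pi> y"]
    unfolding transition_classes_eq by auto
  have finT: "finite T" using fin T(2,3) finite_imageD by metis
  have cardT: "card T = card (transition_classes X \<pi> y)" using T by (simp add: card_image)
  have rep: "\<exists>t\<in>T. (z, t) \<in> ?R" if "z \<in> fiber X \<pi> y" for z
  proof -
    have "?R `` {z} \<in> (\<lambda>x. ?R `` {x}) ` T" using that T(2) unfolding transition_classes_eq by blast
    then obtain t where "t \<in> T" "?R `` {z} = ?R `` {t}" by blast
    moreover from this have "t \<in> X" using T(1) by (auto simp: fiber_def)
    ultimately show ?thesis using eq_equiv_class[OF _ equiv_transition_rel] by blast
  qed
  define f where "f a t = (SOME m. m \<ge> 0 \<and> reach y 0 a m (t m))" for a and t :: "int \<Rightarrow> 'a"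
  have f: "f a t \<ge> 0 \<and> reach y 0 a (f a t) (t (f a t))" if "m \<ge> 0" "reach y 0 a m (t m)" for a t m
    unfolding f_def by (rule someI[of _ m]) (simp add: that)
  obtain m where m: "\<And>a t. a \<in> A \<Longrightarrow> t \<in> T \<Longrightarrow> nat (f a t) \<le> m"
  proof -
    have "finite ((\<lambda>(a, t). nat (f a t)) ` (A \<times> T))" using finite_alphabet finT by simp
    then show thesis using that unfolding finite_nat_set_iff_bounded_le by fastforce
  qed
  have reach_m: "reach y 0 a (int m) (t (int m))"
    if "a \<in> A" "t \<in> T" "i \<ge> 0" "reach y 0 a i (t i)" for a t i
  proof -
    have fa: "f a t \<ge> 0" "reach y 0 a (f a t) (t (f a t))"
      using f[of i a t] that(3,4) by simp_all
    moreover have "f a t \<le> int m" using m[OF that(1,2)] fa(1) by linarith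
    ultimately show ?thesis
      using T(1) that(2) by (intro reach_extend_right[of t y 0 a "f a t" "int m"]) auto
  qed
  define M where "M = (\<lambda>t. t (int m)) ` T"
  have cardM: "ecard M \<le> ecard (transition_classes X \<pi> y)"
    using card_image_le[OF finT, of "\<lambda>t. t (int m)"] finT fin cardT by (simp add: ecard_def M_def)
  \<comment> \<open>The windows run from \<open>- 1 - L\<close> to \<open>m + 1 + L\<close>; inside them, time \<open>m\<close> has index \<open>m + 1 + L\<close>,
    and the margin 1 makes this an interior position.\<close>
  define s where "s L = - 1 - int L" for L
  define len where "len L = m + 2 * L + 3" for L
  define W where "W L = word_at y (s L) (len L)" for L
  have lenW [simp]: "length (W L) = len L" for L by (simp add: W_def)
  have "\<exists>L. transition_block X Y \<pi>b (W L) (m + 1 + L) M"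
  proof (rule ccontr)
    assume no: "\<nexists>L. transition_block X Y \<pi>b (W L) (m + 1 + L) M"
    have "\<exists>U\<in>block_preimages X \<pi>b (W L). \<forall>a\<in>M. \<not> routable X \<pi>b (W L) (m + 1 + L) a U" for L
    proof -
      have "W L \<in> blocks Y" using y by (simp add: W_def word_at_in_blocks)
      moreover have "M \<subseteq> {a. [a] \<in> block_preimages X \<pi>b [W L ! (m + 1 + L)]}"
      proof
        fix a assume "a \<in> M"
        then obtain t where t: "t \<in> T" "a = t (int m)" by (auto simp: M_def)
        then have tX: "t \<in> X" "\<pi>b a = y (int m)" using T(1) fiber_iff by auto
        have "[a] = word_at t (int m) 1" using t by (simp add: word_at_def)
        then have "[a] \<in> blocks X" using word_at_in_blocks[OF tX(1)] by simp
        with tX(2) show "a \<in> {a. [a] \<in> block_preimages X \<pi>b [W L ! (m + 1 + L)]}"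
          by (simp add: block_preimages_def W_def s_def len_def)
      qed
      moreover have "0 < m + 1 + L" "m + 1 + L < length (W L) - 1" by (auto simp: len_def)
      moreover have "\<not> transition_block X Y \<pi>b (W L) (m + 1 + L) M" using no by simp
      ultimately show ?thesis unfolding transition_block_def by simp
    qed
    then have "\<forall>L. \<exists>U. U \<in> block_preimages X \<pi>b (W L) \<and>
        (\<forall>a\<in>M. \<not> routable X \<pi>b (W L) (m + 1 + L) a U)" by blast
    from choice[OF this] obtain U where U: "\<And>L. U L \<in> block_preimages X \<pi>b (W L)"
      "\<And>L a. a \<in> M \<Longrightarrow> \<not> routable X \<pi>b (W L) (m + 1 + L) a (U L)" by blast
    have "\<exists>v\<in>X. (\<forall>j<len L. v (s L + int j) = U L ! j) \<and>
        (\<forall>i. s L \<le> i \<and> i < s L + int (len L) \<longrightarrow> \<pi>b (v i) = y i)" for L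
    proof -
      obtain v where v: "v \<in> X" "\<And>j. j < len L \<Longrightarrow> v (s L + int j) = U L ! j"
        "\<And>i. s L \<le> i \<Longrightarrow> i < s L + int (len L) \<Longrightarrow> \<pi>b (v i) = W L ! nat (i - s L)"
        using block_preimage_point[OF U(1)[of L], of "s L"] unfolding lenW by blast
      have "W L ! nat (i - s L) = y i" if "s L \<le> i" "i < s L + int (len L)" for i
      proof -
        have "nat (i - s L) < len L" using that by linarith
        then show ?thesis using that(1) by (simp add: W_def)
      qed
      with v show ?thesis by (intro bexI[OF _ v(1)]) auto
    qed
    then obtain u where u: "\<And>L. u L \<in> X" "\<And>L j. j < len L \<Longrightarrow> u L (s L + int j) = U L ! j"
      "\<And>L i. s L \<le> i \<Longrightarrow> i < s L + int (len L) \<Longrightarrow> \<pi>b (u L i) = y i" by metis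
    obtain z where z: "\<And>N L. \<exists>L'\<ge>L. agree N (u L') z"
      using cluster_point[of A u] finite_alphabet in_alphabet u(1) by metis
    have "\<pi>b (z i) = y i" for i
    proof -
      obtain L where L: "L \<ge> nat \<bar>i\<bar>" "agree (nat \<bar>i\<bar>) (u L) z" using z by blast
      then have "z i = u L i" by (simp add: agree_def)
      with L(1) u(3)[of L i] show ?thesis by (simp add: s_def len_def)
    qed
    moreover have "z \<in> X" using z u(1) by (intro cluster_in_X) blast
    ultimately have zf: "z \<in> fiber X \<pi> y" by (simp add: fiber_iff)
    then obtain t where t: "t \<in> T" "(z, t) \<in> ?R" using rep by blast
    have tf: "t \<in> fiber X \<pi> y" using t T by blast
    note eq = t(2)[unfolded transition_rel_iff_reach[OF zf tf]]
    have in1: "reach y 0 (z 0) m (t m)"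
      using eq reach_m[of "z 0" t] in_alphabet \<open>z \<in> X\<close> t(1) by blast
    obtain k where k: "k \<ge> int m" "reach y m (t m) k (z k)" using eq by blast
    obtain L where L: "L \<ge> nat k" "agree (nat k) (u L) z" using z by blast
    have u0: "u L 0 = z 0" "u L k = z k" using L(2) k(1) by (simp_all add: agree_def)
    define e where "e = s L + int (len L) - 1"
    have e: "e = int m + 1 + int L" by (simp add: e_def s_def len_def)
    have uy: "\<pi>b (u L i) = y i" if "s L \<le> i" "i \<le> e" for i
      using u(3)[of L i] that by (simp add: e_def)
    have "reach y (s L) (u L (s L)) 0 (u L 0)"
      by (rule reach_along[OF u(1) uy]) (simp_all add: e)
    then have left: "reach y (s L) (u L (s L)) m (t m)"
      unfolding u0(1) by (rule reach_trans[OF _ in1]) (simp_all add: s_def)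
    have "reach y k (u L k) e (u L e)"
      by (rule reach_along[OF u(1) uy]) (use k(1) in \<open>simp_all add: s_def\<close>)
    then have right: "reach y m (t m) e (u L e)"
      unfolding u0(2) by (rule reach_trans[OF k(2)]) (use k(1) L(1) in \<open>simp_all add: e\<close>)
    obtain x where x: "x \<in> X" "x (s L) = u L (s L)" "x m = t m" "x e = u L e"
      "\<And>i. s L \<le> i \<Longrightarrow> i \<le> e \<Longrightarrow> \<pi>b (x i) = y i"
    proof -
      have "s L \<le> int m" "int m \<le> e" by (simp_all add: s_def e)
      show thesis by (rule reach_join[OF left right \<open>s L \<le> int m\<close> \<open>int m \<le> e\<close>]) (rule that)
    qed
    have "routable X \<pi>b (W L) (m + 1 + L) (t m) (U L)"
      unfolding routable_def
    proof (intro bexI conjI)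
      let ?V = "word_at x (s L) (len L)"
      show "?V \<in> block_preimages X \<pi>b (W L)"
        using word_at_in_blocks[OF x(1)] x(5)
        by (auto simp: block_preimages_def list_eq_iff_nth_eq W_def e_def)
      show "?V ! 0 = U L ! 0" using u(2)[of 0 L] x(2) by (simp add: len_def)
      show "?V ! (m + 1 + L) = t m" using x(3) by (simp add: len_def s_def)
      have "len L - 1 < len L" "s L + int (len L - 1) = e" by (simp_all add: e_def len_def)
      then show "?V ! (length (W L) - 1) = U L ! (length (W L) - 1)"
        using u(2)[of "len L - 1" L] x(4) by simp
    qed
    with U(2) t(1) show False by (auto simp: M_def)
  qed
  with cardM show thesis using that by blast
qed

section \<open>Measurability of the number of classes\<close>

definition separated :: "int \<Rightarrow> (int \<Rightarrow> 'b) \<Rightarrow> (int \<Rightarrow> 'a) \<Rightarrow> (int \<Rightarrow> 'a) \<Rightarrow> bool" where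
  "separated n y x x' \<longleftrightarrow> (\<forall>i\<ge>n. \<not> reach y n (x n) i (x' i))"

lemma separated_mono:
  assumes "separated n y x x'" "n \<le> m" "x \<in> fiber X \<pi> y"
  shows "separated m y x x'"
  using assms reach_extend_left[OF assms(3)] unfolding separated_def by (meson order_trans)

definition separated_family :: "nat \<Rightarrow> nat \<Rightarrow> (int \<Rightarrow> 'b) \<Rightarrow> (nat \<Rightarrow> int \<Rightarrow> 'a) \<Rightarrow> bool" where
  "separated_family k N y z \<longleftrightarrow> (\<forall>j<k. z j \<in> fiber X \<pi> y) \<and>
     (\<forall>j<k. \<forall>l<k. j \<noteq> l \<longrightarrow> separated (int N) y (z j) (z l) \<or> separated (int N) y (z l) (z j))"

text \<open>Points over \<open>y\<close> are inequivalent if and only if one of them is separated from the other from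
  some time on. Since separation persists at later times, finitely many pairs share one time \<open>N\<close>.\<close>

lemma class_count_ge_iff_separated:
  "enat k \<le> ecard (transition_classes X \<pi> y) \<longleftrightarrow> (\<exists>N z. separated_family k N y z)"
proof -
  have sep: "(x, x') \<notin> transition_rel X \<pi> \<longleftrightarrow> (\<exists>N::nat. separated N y x x' \<or> separated N y x' x)"
    if x: "x \<in> fiber X \<pi> y" and x': "x' \<in> fiber X \<pi> y" for x x'
  proof -
    have *: "(\<exists>n. separated n y u u') \<longleftrightarrow> (\<exists>N::nat. separated N y u u')" if "u \<in> fiber X \<pi> y" for u u'
      using separated_mono[OF _ _ that, of _ u' "int (nat _)"] by (metis int_nat_eq nat_0_le linear order_refl of_nat_0_le_iff)
    have "(x, x') \<notin> transition_rel X \<pi> \<longleftrightarrow> (\<exists>n. separated n y x x') \<or> (\<exists>n. separated n y x' x)"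
      using transition_rel_iff_reach[OF x x'] unfolding separated_def by blast
    then show ?thesis using *[OF x, of x'] *[OF x', of x] by blast
  qed
  show ?thesis
  proof
    assume "enat k \<le> ecard (transition_classes X \<pi> y)"
    then obtain z where z: "\<And>j. j < k \<Longrightarrow> z j \<in> fiber X \<pi> y"
      and ineq: "\<And>j l. j < k \<Longrightarrow> l < k \<Longrightarrow> j \<noteq> l \<Longrightarrow> (z j, z l) \<notin> transition_rel X \<pi>"
      unfolding class_count_ge_iff by blast
    have "\<exists>N::nat. separated N y (z j) (z l) \<or> separated N y (z l) (z j)"
      if "j < k" "l < k" "j \<noteq> l" for j l
      using sep[OF z z] ineq that by blast
    then obtain f :: "nat \<Rightarrow> nat \<Rightarrow> nat" where f: "\<And>j l. j < k \<Longrightarrow> l < k \<Longrightarrow> j \<noteq> l \<Longrightarrow>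
        separated (f j l) y (z j) (z l) \<or> separated (f j l) y (z l) (z j)" by metis
    have "finite ((\<lambda>(j, l). f j l) ` ({..<k} \<times> {..<k}))" by simp
    then have "\<exists>N. \<forall>j<k. \<forall>l<k. f j l \<le> N" unfolding finite_nat_set_iff_bounded_le by auto
    then obtain N where N: "\<And>j l. j < k \<Longrightarrow> l < k \<Longrightarrow> f j l \<le> N" by blast
    have "separated N y (z j) (z l) \<or> separated N y (z l) (z j)" if "j < k" "l < k" "j \<noteq> l" for j l
      using f[OF that] N[OF that(1,2)] z[OF that(1)] z[OF that(2)] separated_mono by (meson of_nat_mono)
    with z show "\<exists>N z. separated_family k N y z" unfolding separated_family_def by blast
  next
    assume "\<exists>N z. separated_family k N y z"
    then obtain N z where z: "separated_family k N y z" by blast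
    have f: "z j \<in> fiber X \<pi> y" if "j < k" for j using z that by (simp add: separated_family_def)
    have "(z j, z l) \<notin> transition_rel X \<pi>" if "j < k" "l < k" "j \<noteq> l" for j l
      unfolding sep[OF f[OF that(1)] f[OF that(2)]]
      using z that unfolding separated_family_def by blast
    with f show "enat k \<le> ecard (transition_classes X \<pi> y)"
      unfolding class_count_ge_iff by blast
  qed
qed

text \<open>For a fixed \<open>N\<close>, a failure of separation is a path of finite length, so separation is a closed
  condition on the family and \<open>y\<close> jointly. Compactness allows the projection to \<open>y\<close>: a family of
  \<open>k\<close> points is regarded as one sequence over the finite alphabet of words of length \<open>k\<close>, to which
  the existence of cluster points applies.\<close>

lemma closedin_separated_family:
  assumes Y: "closedin seq_topology Y"
  shows "closedin seq_topology {y \<in> Y. \<exists>z. separated_family k N y z}" (is "closedin _ ?D")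
  unfolding closedin_seq_topology
proof (intro allI impI)
  fix y assume "\<forall>L. \<exists>y'\<in>?D. agree L y' y"
  then have "\<forall>L. \<exists>y'. y' \<in> Y \<and> agree L y' y \<and> (\<exists>z. separated_family k N y' z)" by blast
  from choice[OF this] obtain yy where yy: "\<And>L. yy L \<in> Y" "\<And>L. agree L (yy L) y"
    "\<And>L. \<exists>z. separated_family k N (yy L) z" by blast
  have "y \<in> Y" using Y yy(1,2) unfolding closedin_seq_topology by blast
  from yy(3) have "\<forall>L. \<exists>z. separated_family k N (yy L) z" by blast
  from choice[OF this] obtain zz where zz: "\<And>L. separated_family k N (yy L) (zz L)" by blast
  have zf: "zz L j \<in> fiber X \<pi> (yy L)" if "j < k" for L j
    using zz[of L] that by (simp add: separated_family_def)
  define u where "u L i = map (\<lambda>j. zz L j i) [0..<k]" for L i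
  have "u L i \<in> {w. set w \<subseteq> A \<and> length w = k}" for L i
    using zf in_alphabet by (auto simp: u_def fiber_def)
  then obtain w where w: "\<And>M L. \<exists>L'\<ge>L. agree M (u L') w"
    using cluster_point[OF finite_lists_length_eq[OF finite_alphabet, of k], of u] by blast
  define z where "z j i = w i ! j" for j i
  have appr: "\<exists>L. (\<forall>j<k. agree M (zz L j) (z j)) \<and> agree M (yy L) y" for M
  proof -
    obtain L where L: "L \<ge> M" "agree M (u L) w" using w by blast
    have "agree M (zz L j) (z j)" if "j < k" for j
      unfolding agree_def
    proof (intro allI impI)
      fix i :: int assume "\<bar>i\<bar> \<le> int M"
      with L(2) have "w i = u L i" by (simp add: agree_def)
      with that show "zz L j i = z j i" by (simp add: z_def u_def)
    qed
    with agree_mono[OF yy(2)[of L] L(1)] show ?thesis by blast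
  qed
  have "z j \<in> fiber X \<pi> y" if j: "j < k" for j
  proof -
    have "\<exists>x\<in>X. agree M x (z j)" for M using appr[of M] zf[OF j] j by (auto simp: fiber_def)
    then have "z j \<in> X" by (rule cluster_in_X)
    moreover have "\<pi>b (z j i) = y i" for i
    proof -
      obtain L where L: "agree (nat \<bar>i\<bar>) (zz L j) (z j)" "agree (nat \<bar>i\<bar>) (yy L) y"
        using appr[of "nat \<bar>i\<bar>"] j by blast
      then have "z j i = zz L j i" "y i = yy L i" by (simp_all add: agree_def)
      with zf[OF j, of L] show ?thesis by (simp add: fiber_iff)
    qed
    ultimately show ?thesis by (simp add: fiber_iff)
  qed
  moreover have "separated N y (z j) (z l) \<or> separated N y (z l) (z j)"
    if jl: "j < k" "l < k" "j \<noteq> l" for j l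
  proof (rule ccontr)
    assume "\<not> ?thesis"
    then obtain m n where mn: "m \<ge> int N" "n \<ge> int N"
      and r: "reach y N (z j N) m (z l m)" "reach y N (z l N) n (z j n)"
      unfolding separated_def by blast
    obtain L where L: "agree (nat (max m n)) (zz L j) (z j)" "agree (nat (max m n)) (zz L l) (z l)"
      "agree (nat (max m n)) (yy L) y"
      using appr[of "nat (max m n)"] jl by blast
    have eq: "z j i = zz L j i" "z l i = zz L l i" "y i = yy L i" if "int N \<le> i" "i \<le> max m n" for i
      using L that by (simp_all add: agree_def)
    have "reach (yy L) N (zz L j N) m (zz L l m)" "reach (yy L) N (zz L l N) n (zz L j n)"
      using r mn eq(1,2)[of N] eq(1,2)[of m] eq(1,2)[of n]
        reach_cong[of N m y "yy L"] reach_cong[of N n y "yy L"] eq(3) by auto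
    with zz[of L] jl mn show False unfolding separated_family_def separated_def by blast
  qed
  ultimately have "separated_family k N y z" by (simp add: separated_family_def)
  with \<open>y \<in> Y\<close> show "y \<in> ?D" by blast
qed

lemma class_count_measurable:
  assumes "closedin seq_topology Y"
  shows "{y \<in> Y. enat k \<le> ecard (transition_classes X \<pi> y)} \<in>
    sigma_sets Y {U. openin (subtopology seq_topology Y) U}"
proof -
  let ?S = "sigma_sets Y {U. openin (subtopology seq_topology Y) U}"
  have "{y \<in> Y. \<exists>z. separated_family k N y z} \<in> ?S" for N
  proof -
    let ?D = "{y \<in> Y. \<exists>z. separated_family k N y z}"
    have "closedin (subtopology seq_topology Y) ?D"
      by (rule closedin_subset_topspace[OF closedin_separated_family[OF assms]]) auto
    then have "openin (subtopology seq_topology Y) (Y - ?D)"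
      by (simp add: closedin_def)
    then have "Y - (Y - ?D) \<in> ?S" by (intro sigma_sets.Compl sigma_sets.Basic) simp
    moreover have "Y - (Y - ?D) = ?D" by blast
    ultimately show ?thesis by simp
  qed
  then have "(\<Union>N. {y \<in> Y. \<exists>z. separated_family k N y z}) \<in> ?S" by (rule sigma_sets.Union)
  moreover have "(\<Union>N. {y \<in> Y. \<exists>z. separated_family k N y z}) =
      {y \<in> Y. enat k \<le> ecard (transition_classes X \<pi> y)}"
    by (auto simp: class_count_ge_iff_separated)
  ultimately show ?thesis by simp
qed

section \<open>The class degree\<close>

lemma class_degree_eq_min_transition_depth:
  assumes Y: "shift_space Y" and irr: "irreducible_shift Y"
  shows "class_degree X Y \<pi> = min_transition_depth X Y \<pi>b"
proof (rule antisym)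
  show "class_degree X Y \<pi> \<le> min_transition_depth X Y \<pi>b"
    unfolding min_transition_depth_def
  proof (rule Inf_greatest, clarify)
    fix W n M assume tb: "transition_block X Y \<pi>b W n M"
    then have "W \<in> blocks Y" "W \<noteq> []" by (auto simp: transition_block_def)
    then obtain y where y: "y \<in> Y" "infinite {p. 0 < p \<and> occurs_at W y p}"
      using exists_recurring_block[OF Y irr] by blast
    have "class_degree X Y \<pi> \<le> ecard (transition_classes X \<pi> y)"
      unfolding class_degree_def using y(1) by (rule INF_lower)
    also have "\<dots> \<le> ecard M" by (rule class_count_le_transition_block[OF tb y(2)])
    finally show "class_degree X Y \<pi> \<le> ecard M" .
  qed
  show "min_transition_depth X Y \<pi>b \<le> class_degree X Y \<pi>"
    unfolding class_degree_def
  proof (rule INF_greatest)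
    fix y assume y: "y \<in> Y"
    show "min_transition_depth X Y \<pi>b \<le> ecard (transition_classes X \<pi> y)"
    proof (cases "finite (transition_classes X \<pi> y)")
      case True
      obtain W n M where "transition_block X Y \<pi>b W n M"
        and le: "ecard M \<le> ecard (transition_classes X \<pi> y)"
        by (rule transition_block_le_class_count[OF y True])
      then have "min_transition_depth X Y \<pi>b \<le> ecard M"
        unfolding min_transition_depth_def by (intro Inf_lower) blast
      with le show ?thesis by simp
    qed (simp add: ecard_def)
  qed
qed

lemma class_count_right_transitive:
  assumes Y: "shift_space Y" and irr: "irreducible_shift Y" and y: "right_transitive Y y"
  shows "ecard (transition_classes X \<pi> y) = class_degree X Y \<pi>"
proof (rule antisym)
  show "ecard (transition_classes X \<pi> y) \<le> class_degree X Y \<pi>"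
    unfolding class_degree_eq_min_transition_depth[OF Y irr] min_transition_depth_def
  proof (rule Inf_greatest, clarify)
    fix W n M assume tb: "transition_block X Y \<pi>b W n M"
    then have "infinite {p. 0 < p \<and> occurs_at W y p}"
      using y by (auto simp: transition_block_def right_transitive_def)
    with tb show "ecard (transition_classes X \<pi> y) \<le> ecard M"
      by (rule class_count_le_transition_block)
  qed
  show "class_degree X Y \<pi> \<le> ecard (transition_classes X \<pi> y)"
    unfolding class_degree_def using y by (intro INF_lower) (simp add: right_transitive_def)
qed

end

section \<open>Invariance of the number of classes\<close>

lemma class_count_bij:
  assumes bij: "bij_betw h X X'"
    and fib: "\<And>x. x \<in> X \<Longrightarrow> \<pi>' (h x) = y' \<longleftrightarrow> \<pi> x = y"
    and tr: "\<And>x x'. x \<in> X \<Longrightarrow> x' \<in> X \<Longrightarrow> transition X' \<pi>' (h x) (h x') \<longleftrightarrow> transition X \<pi> x x'"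
  shows "ecard (transition_classes X' \<pi>' y') = ecard (transition_classes X \<pi> y)"
proof -
  let ?R = "transition_rel X \<pi>" and ?R' = "transition_rel X' \<pi>'"
  have X': "X' = h ` X" using bij by (simp add: bij_betw_def)
  have cls: "?R' `` {h x} = h ` (?R `` {x})" if "x \<in> X" for x
    using that tr unfolding transition_rel_def X' by auto
  have "X' // ?R' = (\<Union>x\<in>X. {?R' `` {h x}})" by (simp add: quotient_def X')
  also have "\<dots> = (\<Union>x\<in>X. {h ` (?R `` {x})})" using cls by simp
  also have "\<dots> = image h ` (X // ?R)" by (auto simp: quotient_def)
  finally have "X' // ?R' = image h ` (X // ?R)" .
  moreover have "h ` C \<subseteq> {x \<in> X'. \<pi>' x = y'} \<longleftrightarrow> C \<subseteq> {x \<in> X. \<pi> x = y}" if "C \<in> X // ?R" for C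
  proof -
    have "C \<subseteq> X" using that by (auto simp: quotient_def transition_rel_def)
    then show ?thesis using fib unfolding X' by auto
  qed
  ultimately have eq: "transition_classes X' \<pi>' y' = image h ` transition_classes X \<pi> y"
    unfolding transition_classes_def by auto
  have "transition_classes X \<pi> y \<subseteq> Pow X" by (auto simp: transition_classes_def)
  then have "inj_on (image h) (transition_classes X \<pi> y)"
    using bij inj_on_image_Pow inj_on_subset unfolding bij_betw_def by blast
  then show ?thesis unfolding eq ecard_def by (simp add: card_image finite_image_iff)
qed

lemma transitionE:
  assumes "transition X \<pi> x x'"
  obtains v i where "v \<in> X" "\<pi> v = \<pi> x" "\<pi> x = \<pi> x'" "\<And>j. j \<le> n \<Longrightarrow> v j = x j"
    "n \<le> i" "\<And>j. i \<le> j \<Longrightarrow> v j = x' j"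
proof -
  from assms[unfolded transition_def, THEN spec, of n] that show thesis by blast
qed

lemma inj_shift_map: "inj shift_map"
proof (rule injI, rule ext)
  fix x x' :: "int \<Rightarrow> 'a" and i assume "shift_map x = shift_map x'"
  from fun_cong[OF this, of "i - 1"] show "x i = x' i" by (simp add: shift_map_def)
qed

lemma transition_shift:
  assumes f: "factor_code X Y \<pi>" and x: "x \<in> X" "x' \<in> X"
  shows "transition X \<pi> (shift_map x) (shift_map x') \<longleftrightarrow> transition X \<pi> x x'"
proof -
  have X: "shift_map ` X = X" and comm: "\<And>x. x \<in> X \<Longrightarrow> \<pi> (shift_map x) = shift_map (\<pi> x)"
    using f by (auto simp: factor_code_def shift_space_def)
  note inj = inj_eq[OF inj_shift_map]
  show ?thesis
  proof
    assume T: "transition X \<pi> (shift_map x) (shift_map x')"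
    show "transition X \<pi> x x'"
      unfolding transition_def
    proof
      fix n
      obtain v i where v: "v \<in> X" "\<pi> v = \<pi> (shift_map x)" "\<pi> (shift_map x) = \<pi> (shift_map x')"
        "\<And>j. j \<le> n - 1 \<Longrightarrow> v j = shift_map x j" "i \<ge> n - 1" "\<And>j. j \<ge> i \<Longrightarrow> v j = shift_map x' j"
        using transitionE[OF T, of "n - 1"] by blast
      obtain u where u: "u \<in> X" "v = shift_map u" using v(1) X by blast
      have "\<pi> u = \<pi> x" "\<pi> x = \<pi> x'" using v(2,3) u x comm by (auto simp: inj)
      moreover have "u j = x j" if "j \<le> n" for j
        using v(4)[of "j - 1"] that u(2) by (simp add: shift_map_def)
      moreover have "u j = x' j" if "j \<ge> i + 1" for j
        using v(6)[of "j - 1"] that u(2) by (simp add: shift_map_def)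
      moreover have "i + 1 \<ge> n" using v(5) by simp
      ultimately show "\<exists>v\<in>X. \<pi> v = \<pi> x \<and> \<pi> x = \<pi> x' \<and> (\<forall>j\<le>n. v j = x j) \<and>
          (\<exists>i\<ge>n. \<forall>j\<ge>i. v j = x' j)" using u(1) by blast
    qed
  next
    assume T: "transition X \<pi> x x'"
    show "transition X \<pi> (shift_map x) (shift_map x')"
      unfolding transition_def
    proof
      fix n
      obtain v i where v: "v \<in> X" "\<pi> v = \<pi> x" "\<pi> x = \<pi> x'"
        "\<And>j. j \<le> n + 1 \<Longrightarrow> v j = x j" "i \<ge> n + 1" "\<And>j. j \<ge> i \<Longrightarrow> v j = x' j"
        using transitionE[OF T, of "n + 1"] by blast
      have "shift_map v \<in> X" using v(1) X by blast
      moreover have "\<pi> (shift_map v) = \<pi> (shift_map x)" "\<pi> (shift_map x) = \<pi> (shift_map x')"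
        using v(1-3) x comm by auto
      moreover have "\<forall>j\<le>n. shift_map v j = shift_map x j"
        using v(4) by (simp add: shift_map_def)
      moreover have "\<forall>j\<ge>i - 1. shift_map v j = shift_map x' j" "i - 1 \<ge> n"
        using v(5,6) by (simp_all add: shift_map_def)
      ultimately show "\<exists>v\<in>X. \<pi> v = \<pi> (shift_map x) \<and> \<pi> (shift_map x) = \<pi> (shift_map x') \<and>
          (\<forall>j\<le>n. v j = shift_map x j) \<and> (\<exists>i\<ge>n. \<forall>j\<ge>i. v j = shift_map x' j)" by blast
    qed
  qed
qed

lemma class_count_shift:
  assumes f: "factor_code X Y \<pi>"
  shows "ecard (transition_classes X \<pi> (shift_map y)) = ecard (transition_classes X \<pi> y)"
proof (rule class_count_bij)
  have "shift_map ` X = X" using f by (simp add: factor_code_def shift_space_def)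
  then show "bij_betw shift_map X X"
    using inj_shift_map by (auto simp: bij_betw_def intro: inj_on_subset)
  show "\<pi> (shift_map x) = shift_map y \<longleftrightarrow> \<pi> x = y" if "x \<in> X" for x
    using f that inj_shift_map by (auto simp: factor_code_def dest: injD)
qed (rule transition_shift[OF f])

text \<open>Each set \<open>{y. k \<le> f y}\<close> is invariant, hence null or conull, and countably many of these sets
  determine \<open>f\<close>.\<close>

lemma ergodic_AE_const:
  fixes f :: "(int \<Rightarrow> 'b) \<Rightarrow> enat"
  assumes erg: "ergodic_measure Y \<nu>" and Y: "shift_space Y"
    and inv: "\<And>y. y \<in> Y \<Longrightarrow> f (shift_map y) = f y"
    and meas: "\<And>k. {y \<in> Y. enat k \<le> f y} \<in> sets \<nu>"
  shows "\<exists>c. AE y in \<nu>. f y = c"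
proof -
  interpret prob_space \<nu> using erg by (simp add: ergodic_measure_def)
  have sp: "space \<nu> = Y" using erg by (simp add: ergodic_measure_def)
  define B where "B k = {y \<in> Y. enat k \<le> f y}" for k
  have zero_one: "(AE y in \<nu>. enat k \<le> f y) \<or> (AE y in \<nu>. \<not> enat k \<le> f y)" for k
  proof -
    have BY: "B k \<subseteq> Y" and Bs: "B k \<in> sets \<nu>" using meas by (auto simp: B_def)
    have "shift_map y \<in> Y" if "y \<in> Y" for y using Y that by (auto simp: shift_space_def)
    then have "shift_map -` B k \<inter> Y = B k" using inv by (auto simp: B_def)
    then have "emeasure \<nu> (B k) = 0 \<or> emeasure \<nu> (B k) = 1"
      using erg Bs by (simp add: ergodic_measure_def)
    then show ?thesis
    proof
      assume "emeasure \<nu> (B k) = 0"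
      then have "AE y in \<nu>. y \<notin> B k" using Bs by (intro AE_not_in) auto
      then have "AE y in \<nu>. \<not> enat k \<le> f y"
        using AE_space by eventually_elim (simp add: B_def sp)
      then show ?thesis ..
    next
      assume "emeasure \<nu> (B k) = 1"
      then have "AE y in \<nu>. y \<in> B k" by (intro AE_prob_1) (simp add: measure_def)
      then have "AE y in \<nu>. enat k \<le> f y" by eventually_elim (simp add: B_def)
      then show ?thesis ..
    qed
  qed
  define P where "P k \<longleftrightarrow> (AE y in \<nu>. enat k \<le> f y)" for k
  have "AE y in \<nu>. enat k \<le> f y \<longleftrightarrow> P k" for k
    using zero_one[of k] by (cases "P k") (auto simp: P_def)
  then have ae: "AE y in \<nu>. \<forall>k. enat k \<le> f y \<longleftrightarrow> P k" by (simp add: AE_all_countable)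
  have "\<exists>y0. \<forall>k. enat k \<le> f y0 \<longleftrightarrow> P k"
    using eventually_happens'[OF ae_filter_bot ae] .
  then obtain y0 where y0: "\<forall>k. enat k \<le> f y0 \<longleftrightarrow> P k" by blast
  have le: "e \<le> e'" if "\<And>k. enat k \<le> e \<Longrightarrow> enat k \<le> e'" for e e' :: enat
  proof (cases e)
    case (enat n)
    then show ?thesis using that[of n] by simp
  next
    case infinity
    then show ?thesis
    proof (cases e')
      case (enat m)
      then show ?thesis using that[of "Suc m"] infinity by simp
    qed simp
  qed
  have "AE y in \<nu>. f y = f y0"
    using ae
  proof eventually_elim
    case (elim y)
    show ?case
    proof (rule antisym)
      show "f y \<le> f y0" by (rule le) (use elim y0 in blast)
      show "f y0 \<le> f y" by (rule le) (use elim y0 in blast)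
    qed
  qed
  then show ?thesis ..
qed

lemma shift_map_translate: "shift_map (\<lambda>i. x (i + k)) = (\<lambda>i. x (i + (k + 1)))"
  by (simp add: shift_map_def fun_eq_iff ac_simps)

section \<open>Recoding to a 1-block code on a 1-step shift\<close>

lemma factor_code_translate:
  assumes f: "factor_code X Y \<pi>" and x: "x \<in> X"
  shows "\<pi> (\<lambda>i. x (i + k)) = (\<lambda>i. \<pi> x (i + k))"
proof (induction k rule: int_induct[of _ 0])
  case base
  then show ?case by simp
next
  case (step1 k)
  have X: "(\<lambda>i. x (i + k)) \<in> X"
    using f x by (intro shift_space_translate) (auto simp: factor_code_def)
  have "\<pi> (shift_map (\<lambda>i. x (i + k))) = shift_map (\<pi> (\<lambda>i. x (i + k)))"
    using f X by (simp add: factor_code_def)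
  then show ?case unfolding step1.IH shift_map_translate .
next
  case (step2 k)
  have X: "(\<lambda>i. x (i + (k - 1))) \<in> X"
    using f x by (intro shift_space_translate) (auto simp: factor_code_def)
  have "shift_map (\<pi> (\<lambda>i. x (i + (k - 1)))) = \<pi> (shift_map (\<lambda>i. x (i + (k - 1))))"
    using f X by (simp add: factor_code_def)
  also have "\<dots> = shift_map (\<lambda>i. \<pi> x (i + (k - 1)))"
    using step2.IH unfolding shift_map_translate by simp
  finally show ?case using inj_shift_map by (auto dest: injD)
qed

text \<open>The higher block code; centering the window at \<open>i\<close> makes the original point the sequence of
  middle symbols.\<close>

definition window_code :: "nat \<Rightarrow> (int \<Rightarrow> 'a) \<Rightarrow> int \<Rightarrow> 'a list" where
  "window_code r x i = word_at x (i - int r) (2 * r + 1)"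

lemma nth_window_code: "m < 2 * r + 1 \<Longrightarrow> window_code r x i ! m = x (i - int r + int m)"
  by (simp add: window_code_def)

lemma window_code_center: "(\<lambda>i. window_code r x i ! r) = x"
  by (simp add: nth_window_code)

lemma window_code_eqI:
  "(\<And>j. i - int r \<le> j \<Longrightarrow> j \<le> i + int r \<Longrightarrow> x j = x' j) \<Longrightarrow> window_code r x i = window_code r x' i"
  by (simp add: window_code_def list_eq_iff_nth_eq)

lemma window_code_eqD:
  "window_code r x i = window_code r x' i' \<Longrightarrow> \<bar>d\<bar> \<le> int r \<Longrightarrow> x (i + d) = x' (i' + d)"
proof -
  assume eq: "window_code r x i = window_code r x' i'" and "\<bar>d\<bar> \<le> int r"
  then have "nat (d + int r) < 2 * r + 1" "int (nat (d + int r)) = d + int r" by linarith+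
  with eq nth_window_code[of "nat (d + int r)" r x i] nth_window_code[of "nat (d + int r)" r x' i']
  show "x (i + d) = x' (i' + d)" by simp
qed

text \<open>Consecutive windows that occur next to each other in recoded points overlap consistently, so
  they come from a single sequence \<open>t\<close>; each forbidden word fits into one window and is thus
  excluded from \<open>t\<close>.\<close>

lemma one_step_window_code:
  fixes X :: "(int \<Rightarrow> 'a) set"
  assumes X: "X = {x. range x \<subseteq> A \<and> (\<forall>w\<in>F. \<forall>i. \<not> occurs_at w x i)}"
    and r: "\<And>w. w \<in> F \<Longrightarrow> length w \<le> 2 * r + 1"
  shows "one_step (window_code r ` X)" (is "one_step ?X")
  unfolding one_step_def
proof (intro allI iffI)
  fix z i assume "z \<in> ?X"
  moreover have "[z i, z (i + 1)] = word_at z i 2" by (simp add: word_at_def numeral_2_eq_2)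
  ultimately show "[z i, z (i + 1)] \<in> blocks ?X" by (simp add: word_at_in_blocks)
next
  fix z :: "int \<Rightarrow> 'a list" assume blk: "\<forall>i. [z i, z (i + 1)] \<in> blocks ?X"
  have loc: "\<exists>x\<in>X. \<exists>j. z i = window_code r x j \<and> z (i + 1) = window_code r x (j + 1)" for i
  proof -
    obtain x j where "x \<in> X" "occurs_at [z i, z (i + 1)] (window_code r x) j"
      using blk unfolding blocks_def by blast
    then show ?thesis by (auto simp: occurs_at_iff less_Suc_eq all_conj_distrib intro!: bexI[of _ x] exI[of _ j])
  qed
  \<comment> \<open>Moving one step to the right lowers the index inside the window by one.\<close>
  have overlap: "z i ! (m + d) = z (i + int d) ! m" if "m + d \<le> 2 * r" for i :: int and m d
    using that
  proof (induction d arbitrary: i)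
    case (Suc d)
    obtain x j where "z i = window_code r x j" "z (i + 1) = window_code r x (j + 1)"
      using loc by blast
    then have "z i ! (m + Suc d) = z (i + 1) ! (m + d)"
      using Suc.prems by (simp add: nth_window_code algebra_simps)
    with Suc.IH[of "i + 1"] Suc.prems show ?case by (simp add: algebra_simps)
  qed simp
  define t where "t i = z i ! r" for i
  have zt: "z i = window_code r t i" for i
  proof (rule nth_equalityI)
    show "length (z i) = length (window_code r t i)"
      using loc[of i] by (auto simp: window_code_def)
    fix m assume "m < length (z i)"
    then have m: "m < 2 * r + 1" using loc[of i] by (auto simp: window_code_def)
    show "z i ! m = window_code r t i ! m"
    proof (cases "r \<le> m")
      case True
      then show ?thesis
        using overlap[of r "m - r" i] m by (simp add: nth_window_code t_def of_nat_diff algebra_simps)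
    next
      case False
      then show ?thesis
        using overlap[of m "r - m" "i - int (r - m)"]
        by (simp add: nth_window_code t_def of_nat_diff algebra_simps)
    qed
  qed
  have near: "\<exists>x\<in>X. \<exists>j. \<forall>d. \<bar>d\<bar> \<le> int r \<longrightarrow> t (i + d) = x (j + d)" for i
    using loc[of i] zt[of i] by (metis window_code_eqD)
  have "t \<in> X"
    unfolding X
  proof (intro CollectI conjI ballI allI notI subsetI)
    fix a assume "a \<in> range t"
    then obtain i where "a = t i" by blast
    with near[of i] show "a \<in> A" unfolding X by (force dest: spec[of _ "0::int"])
  next
    fix w p assume w: "w \<in> F" "occurs_at w t p"
    obtain x j where x: "x \<in> X" "\<forall>d. \<bar>d\<bar> \<le> int r \<longrightarrow> t (p + int r + d) = x (j + d)"
      using near by blast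
    have "x (j - int r + int m) = w ! m" if "m < length w" for m
      using x(2)[rule_format, of "int m - int r"] r[OF w(1)] w(2) that
      by (simp add: occurs_at_iff algebra_simps)
    then have "occurs_at w x (j - int r)" by (simp add: occurs_at_iff)
    with x(1) w(1) show False by (simp add: X)
  qed
  then show "z \<in> ?X" using zt by blast
qed

text \<open>Agreement of recoded points loses \<open>r\<close> coordinates at the boundary, which is harmless because
  transitions are required at all times.\<close>

lemma transition_window_code:
  fixes \<pi> :: "(int \<Rightarrow> 'a) \<Rightarrow> (int \<Rightarrow> 'b)" and r :: nat
  defines "\<pi>' \<equiv> \<lambda>z. \<pi> (\<lambda>i. z i ! r)"
  shows "transition (window_code r ` X) \<pi>' (window_code r x) (window_code r x') \<longleftrightarrow> transition X \<pi> x x'"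
proof -
  have \<pi>': "\<pi>' (window_code r u) = \<pi> u" for u by (simp add: \<pi>'_def window_code_center)
  have center: "window_code r u j = window_code r v j \<Longrightarrow> u j = v j" for u v :: "int \<Rightarrow> 'a" and j
    using window_code_eqD[of r u j v j 0] by simp
  show ?thesis
  proof
    assume T: "transition (window_code r ` X) \<pi>' (window_code r x) (window_code r x')"
    show "transition X \<pi> x x'"
      unfolding transition_def
    proof
      fix n
      obtain w i where w: "w \<in> window_code r ` X" "\<pi>' w = \<pi>' (window_code r x)"
        "\<pi>' (window_code r x) = \<pi>' (window_code r x')"
        "\<And>j. j \<le> n \<Longrightarrow> w j = window_code r x j" "n \<le> i" "\<And>j. i \<le> j \<Longrightarrow> w j = window_code r x' j"
        using transitionE[OF T, of n] by blast
      obtain v where v: "v \<in> X" "w = window_code r v" using w(1) by blast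
      have "\<forall>j\<le>n. v j = x j" "\<forall>j\<ge>i. v j = x' j" using w(4,6) center unfolding v(2) by blast+
      then show "\<exists>v\<in>X. \<pi> v = \<pi> x \<and> \<pi> x = \<pi> x' \<and> (\<forall>j\<le>n. v j = x j) \<and>
          (\<exists>i\<ge>n. \<forall>j\<ge>i. v j = x' j)" using w(2,3,5) v unfolding v(2) \<pi>' by blast
    qed
  next
    assume T: "transition X \<pi> x x'"
    show "transition (window_code r ` X) \<pi>' (window_code r x) (window_code r x')"
      unfolding transition_def
    proof
      fix n
      obtain v i where v: "v \<in> X" "\<pi> v = \<pi> x" "\<pi> x = \<pi> x'" "\<And>j. j \<le> n + int r \<Longrightarrow> v j = x j"
        "i \<ge> n + int r" "\<And>j. j \<ge> i \<Longrightarrow> v j = x' j"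
        using transitionE[OF T, of "n + int r"] by blast
      have "\<forall>j\<le>n. window_code r v j = window_code r x j"
        using v(4) by (auto intro!: window_code_eqI)
      moreover have "\<forall>j\<ge>i + int r. window_code r v j = window_code r x' j"
        using v(6) by (auto intro!: window_code_eqI)
      moreover have "i + int r \<ge> n" using v(5) by simp
      ultimately show "\<exists>v\<in>window_code r ` X. \<pi>' v = \<pi>' (window_code r x) \<and>
          \<pi>' (window_code r x) = \<pi>' (window_code r x') \<and> (\<forall>j\<le>n. v j = window_code r x j) \<and>
          (\<exists>i\<ge>n. \<forall>j\<ge>i. v j = window_code r x' j)"
        using v(1-3) by (intro bexI[of _ "window_code r v"]) (auto simp: \<pi>')
    qed
  qed
qed

lemma sft_recoding:
  fixes X :: "(int \<Rightarrow> 'a) set" and \<pi> :: "(int \<Rightarrow> 'a) \<Rightarrow> (int \<Rightarrow> 'b)"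
  assumes sft: "sft X" and f: "factor_code X Y \<pi>"
  obtains X' :: "(int \<Rightarrow> 'a list) set" and \<pi>' \<pi>b A where "one_step_code X' \<pi>' \<pi>b A"
    "\<And>y. ecard (transition_classes X' \<pi>' y) = ecard (transition_classes X \<pi> y)"
proof -
  obtain A F where A: "finite A" and F: "finite F"
    and X: "X = {x. range x \<subseteq> A \<and> (\<forall>w\<in>F. \<forall>i. \<not> occurs_at w x i)}"
    using sft unfolding sft_def by blast
  have inA: "x i \<in> A" if "x \<in> X" for x i using that by (auto simp: X)
  obtain r0 where r0: "\<And>x x'. x \<in> X \<Longrightarrow> x' \<in> X \<Longrightarrow> agree r0 x x' \<Longrightarrow> \<pi> x 0 = \<pi> x' 0"
    using continuous_imp_local[of A X Y \<pi>] A inA f by (auto simp: factor_code_def shift_space_def)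
  obtain K where K: "\<And>w. w \<in> F \<Longrightarrow> length w \<le> K"
    using finite_imageI[OF F, of length] unfolding finite_nat_set_iff_bounded_le by auto
  \<comment> \<open>A window of radius \<open>r\<close> determines the image symbol at its center and contains every
    forbidden word.\<close>
  define r where "r = r0 + K"
  define X' where "X' = window_code r ` X"
  define \<pi>' where "\<pi>' = (\<lambda>z::int \<Rightarrow> 'a list. \<pi> (\<lambda>i. z i ! r))"
  define \<pi>b where "\<pi>b w = \<pi> (SOME x. x \<in> X \<and> window_code r x 0 = w) 0" for w
  have \<pi>': "\<pi>' (window_code r u) = \<pi> u" for u by (simp add: \<pi>'_def window_code_center)
  have "one_step_code X' \<pi>' \<pi>b {w. set w \<subseteq> A \<and> length w = 2 * r + 1}"
  proof
    show "finite {w. set w \<subseteq> A \<and> length w = 2 * r + 1}" using A by (rule finite_lists_length_eq)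
    show "z i \<in> {w. set w \<subseteq> A \<and> length w = 2 * r + 1}" if "z \<in> X'" for z i
      using that inA by (auto simp: X'_def window_code_def word_at_def)
    have "length w \<le> 2 * r + 1" if "w \<in> F" for w using K[OF that] by (simp add: r_def)
    then show "one_step X'" unfolding X'_def by (intro one_step_window_code[OF X])
    show "one_block_code X' \<pi>' \<pi>b"
      unfolding one_block_code_def X'_def
    proof (clarify)
      fix x i assume x: "x \<in> X"
      let ?x = "\<lambda>j. x (j + i)"
      let ?w = "window_code r x i"
      have X1: "?x \<in> X" using f x by (intro shift_space_translate) (auto simp: factor_code_def)
      have w: "window_code r ?x 0 = ?w"
        by (simp add: window_code_def word_at_def algebra_simps)
      define x' where "x' = (SOME x'. x' \<in> X \<and> window_code r x' 0 = ?w)"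
      have x': "x' \<in> X" "window_code r x' 0 = ?w"
        using someI[of "\<lambda>x'. x' \<in> X \<and> window_code r x' 0 = ?w" ?x] X1 w by (auto simp: x'_def)
      have "agree r0 x' ?x"
        unfolding agree_def using window_code_eqD[of r x' 0 ?x 0] x'(2) w by (simp add: r_def)
      then have "\<pi> x' 0 = \<pi> ?x 0" using r0 x'(1) X1 by blast
      also have "\<dots> = \<pi> x i" using factor_code_translate[OF f x, of i] by simp
      finally show "\<pi>' (window_code r x) i = \<pi>b ?w"
        by (simp add: \<pi>' \<pi>b_def x'_def)
    qed
  qed
  moreover have "ecard (transition_classes X' \<pi>' y) = ecard (transition_classes X \<pi> y)" for y
    unfolding X'_def
  proof (rule class_count_bij)
    have "inj_on (window_code r) X" by (rule inj_onI) (metis window_code_center)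
    then show "bij_betw (window_code r) X (window_code r ` X)" by (simp add: bij_betw_def)
  qed (simp_all add: \<pi>' transition_window_code[where \<pi> = \<pi> and r = r, folded \<pi>'_def])
  ultimately show thesis by (rule that)
qed

section \<open>Class degree, right transitive points and ergodic measures\<close>

theorem corollary4p23:
  fixes X :: "(int \<Rightarrow> 'a) set" and Y :: "(int \<Rightarrow> 'b) set"
    and \<pi> :: "(int \<Rightarrow> 'a) \<Rightarrow> (int \<Rightarrow> 'b)"
  assumes "sft X" and "sofic Y" and "irreducible_shift Y" and "factor_code X Y \<pi>"
  shows "(one_step X \<longrightarrow>
            (\<forall>\<pi>b. one_block_code X \<pi> \<pi>b \<longrightarrow> class_degree X Y \<pi> = min_transition_depth X Y \<pi>b))
       \<and> (\<forall>y. right_transitive Y y \<longrightarrow> ecard (transition_classes X \<pi> y) = class_degree X Y \<pi>)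
       \<and> (\<forall>\<nu>. ergodic_measure Y \<nu> \<longrightarrow>
            (\<exists>k. AE y in \<nu>. ecard (transition_classes X \<pi> y) = k))"
proof -
  have Y: "shift_space Y" and X: "shift_space X" using assms(4) by (auto simp: factor_code_def)
  obtain X' :: "(int \<Rightarrow> 'a list) set" and \<pi>' \<pi>b' A' where "one_step_code X' \<pi>' \<pi>b' A'"
    and count: "\<And>y. ecard (transition_classes X' \<pi>' y) = ecard (transition_classes X \<pi> y)"
    using sft_recoding[OF assms(1,4)] by blast
  then interpret recoded: one_step_code X' \<pi>' \<pi>b' A' by simp
  have degree: "class_degree X' Y \<pi>' = class_degree X Y \<pi>"
    by (simp add: class_degree_def count)
  show ?thesis
  proof (intro conjI impI allI)
    fix \<pi>b assume "one_step X" "one_block_code X \<pi> \<pi>b"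
    moreover obtain A where "finite A" "\<forall>x\<in>X. range x \<subseteq> A" using X by (auto simp: shift_space_def)
    ultimately interpret one_step_code X \<pi> \<pi>b A by unfold_locales auto
    show "class_degree X Y \<pi> = min_transition_depth X Y \<pi>b"
      by (rule class_degree_eq_min_transition_depth[OF Y assms(3)])
  next
    fix y assume "right_transitive Y y"
    then show "ecard (transition_classes X \<pi> y) = class_degree X Y \<pi>"
      using recoded.class_count_right_transitive[OF Y assms(3)] by (simp add: count degree)
  next
    fix \<nu> assume erg: "ergodic_measure Y \<nu>"
    have "closedin seq_topology Y" using Y by (simp add: shift_space_def)
    then have "{y \<in> Y. enat k \<le> ecard (transition_classes X \<pi> y)} \<in> sets \<nu>" for k
      using recoded.class_count_measurable[of Y k] erg by (simp add: count ergodic_measure_def)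
    with erg Y class_count_shift[OF assms(4)]
    show "\<exists>k. AE y in \<nu>. ecard (transition_classes X \<pi> y) = k"
      by (intro ergodic_AE_const)
  qed
qed

end
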